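(* Let $\mathscr{A}$ be an abelian category with enough injective objects, let $\mathscr{E}$ be a subcategory of $\mathscr{A}$, and let $\mathscr{T}$ be a coresolving subcategory of $\mathscr{A}$ admitting an $\mathscr{E}$-proper generator $\mathscr{C}$. Then (1) $\mathscr{T}\text{-}\mathrm{FID}\leq\mathscr{C}\text{-}\mathrm{FID}$. (2) If $\mathscr{T}\subseteq{\mathscr{C}^{\bot}}$, then $\mathscr{T}\text{-}\operatorname{id} M=\mathscr{C}\text{-}\operatorname{id} M$ for any $M\in\mathscr{A}$ with $\mathscr{C}\text{-}\operatorname{id} M<\infty$. (3) If $\mathscr{T}\subseteq{\mathscr{C}^{\bot}}$, then $\mathscr{T}\text{-}\mathrm{FID}=\mathscr{C}\text{-}\mathrm{FID}$.
   Context: All subcategories are full, additive and closed under isomorphisms and direct summands. For a subcategory $\mathscr{X}$ of $\mathscr{A}$ and $M\in\mathscr{A}$, $\mathscr{X}\text{-}\operatorname{id} M$ is the infimum of the integers $n\ge 0$ such that there is an exact sequence $0 \to M\to X^0\to\cdots \to X^n\to 0$ in $\mathscr{A}$ with all $X^i\in\mathscr{X}$ ($\infty$ if no such $n$ exists), and $\mathscr{X}\text{-}\mathrm{FID}:=\sup\{\mathscr{X}\text{-}\operatorname{id} M\mid M\in\mathscr{A},\ \mathscr{X}\text{-}\operatorname{id} M<\infty\}$. $\mathscr{X}^\perp:=\{A\in\mathscr{A}\mid\operatorname{Ext}^{\geq 1}_{\mathscr{A}}(X,A)=0 \text{ for any } X\in \mathscr{X}\}$. A subcategory is coresolving if it contains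 all injective objects and is closed under extensions and cokernels of monomorphisms. For subcategories $\mathscr{C}\subseteq\mathscr{T}$, $\mathscr{C}$ is an $\mathscr{E}$-proper generator for $\mathscr{T}$ if for any $T\in\mathscr{T}$ there is an exact sequence $0\to T'\to C\to T\to 0$ in $\mathscr{A}$ with $C\in\mathscr{C}$, $T'\in\mathscr{T}$, which remains exact under $\operatorname{Hom}_{\mathscr{A}}(E,-)$ for every $E\in\mathscr{E}$. *)

theory Defs
  imports "HOL-Algebra.Exact_Sequence" "HOL-Library.Extended_Nat"
begin

section \<open>Abelian categories\<close>

text \<open>
  The additive structure of the hom-sets is part of the data: \<open>Add\<close> is the sum of parallel
  arrows and \<open>Zero A X Y\<close> is the neutral element of \<open>Hom X Y\<close>. Composition is written in
  the usual order, so \<open>g \<cdot> f\<close> means ``first \<open>f\<close>, then \<open>g\<close>''.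
\<close>

record ('o, 'm) precategory =
  Obj :: "'o set"
  Arr :: "'m set"
  Dom :: "'m \<Rightarrow> 'o"
  Cod :: "'m \<Rightarrow> 'o"
  Ident :: "'o \<Rightarrow> 'm"
  Comp :: "'m \<Rightarrow> 'm \<Rightarrow> 'm"  (infixl "\<cdot>\<index>" 70)
  Add :: "'m \<Rightarrow> 'm \<Rightarrow> 'm"
  Zero :: "'o \<Rightarrow> 'o \<Rightarrow> 'm"

definition Hom :: "('o, 'm) precategory \<Rightarrow> 'o \<Rightarrow> 'o \<Rightarrow> 'm set" where
  "Hom A X Y = {f \<in> Arr A. Dom A f = X \<and> Cod A f = Y}"

text \<open>The additive group \<open>Hom X Y\<close>, in the multiplicative vocabulary of HOL-Algebra.\<close>

definition hom_group :: "('o, 'm) precategory \<Rightarrow> 'o \<Rightarrow> 'o \<Rightarrow> 'm monoid" where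
  "hom_group A X Y = \<lparr>carrier = Hom A X Y, monoid.mult = Add A, one = Zero A X Y\<rparr>"

locale preadditive_category =
  fixes A :: "('o, 'm) precategory" (structure)
  assumes Dom_in_Obj: "f \<in> Arr A \<Longrightarrow> Dom A f \<in> Obj A"
    and Cod_in_Obj: "f \<in> Arr A \<Longrightarrow> Cod A f \<in> Obj A"
    and Ident_in_Hom: "X \<in> Obj A \<Longrightarrow> Ident A X \<in> Hom A X X"
    and Comp_in_Hom: "\<lbrakk>f \<in> Hom A X Y; g \<in> Hom A Y Z\<rbrakk> \<Longrightarrow> g \<cdot> f \<in> Hom A X Z"
    and Comp_Ident: "f \<in> Hom A X Y \<Longrightarrow> f \<cdot> Ident A X = f"
    and Ident_Comp: "f \<in> Hom A X Y \<Longrightarrow> Ident A Y \<cdot> f = f"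
    and Comp_assoc:
      "\<lbrakk>f \<in> Hom A W X; g \<in> Hom A X Y; h \<in> Hom A Y Z\<rbrakk> \<Longrightarrow> (h \<cdot> g) \<cdot> f = h \<cdot> (g \<cdot> f)"
    and hom_comm_group: "\<lbrakk>X \<in> Obj A; Y \<in> Obj A\<rbrakk> \<Longrightarrow> comm_group (hom_group A X Y)"
    and Comp_Add:
      "\<lbrakk>f \<in> Hom A X Y; f' \<in> Hom A X Y; g \<in> Hom A Y Z\<rbrakk> \<Longrightarrow> g \<cdot> Add A f f' = Add A (g \<cdot> f) (g \<cdot> f')"
    and Add_Comp:
      "\<lbrakk>f \<in> Hom A X Y; g \<in> Hom A Y Z; g' \<in> Hom A Y Z\<rbrakk> \<Longrightarrow> Add A g g' \<cdot> f = Add A (g \<cdot> f) (g' \<cdot> f)"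

definition zero_object :: "('o, 'm) precategory \<Rightarrow> 'o \<Rightarrow> bool" where
  "zero_object A Z \<longleftrightarrow>
     Z \<in> Obj A \<and> (\<forall>X\<in>Obj A. (\<exists>!f. f \<in> Hom A Z X) \<and> (\<exists>!f. f \<in> Hom A X Z))"

definition biproduct ::
  "('o, 'm) precategory \<Rightarrow> 'o \<Rightarrow> 'o \<Rightarrow> 'o \<Rightarrow> 'm \<Rightarrow> 'm \<Rightarrow> 'm \<Rightarrow> 'm \<Rightarrow> bool" where
  "biproduct A X Y S i j p q \<longleftrightarrow>
     i \<in> Hom A X S \<and> j \<in> Hom A Y S \<and> p \<in> Hom A S X \<and> q \<in> Hom A S Y \<and>
     p \<cdot>\<^bsub>A\<^esub> i = Ident A X \<and> q \<cdot>\<^bsub>A\<^esub> j = Ident A Y \<and>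
     p \<cdot>\<^bsub>A\<^esub> j = Zero A Y X \<and> q \<cdot>\<^bsub>A\<^esub> i = Zero A X Y \<and>
     Add A (i \<cdot>\<^bsub>A\<^esub> p) (j \<cdot>\<^bsub>A\<^esub> q) = Ident A S"

definition direct_sum :: "('o, 'm) precategory \<Rightarrow> 'o \<Rightarrow> 'o \<Rightarrow> 'o \<Rightarrow> bool" where
  "direct_sum A X Y S \<longleftrightarrow>
     X \<in> Obj A \<and> Y \<in> Obj A \<and> S \<in> Obj A \<and> (\<exists>i j p q. biproduct A X Y S i j p q)"

definition monic :: "('o, 'm) precategory \<Rightarrow> 'm \<Rightarrow> bool" where
  "monic A f \<longleftrightarrow> f \<in> Arr A \<and>
     (\<forall>W. \<forall>g\<in>Hom A W (Dom A f). \<forall>h\<in>Hom A W (Dom A f). f \<cdot>\<^bsub>A\<^esub> g = f \<cdot>\<^bsub>A\<^esub> h \<longrightarrow> g = h)"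

definition epic :: "('o, 'm) precategory \<Rightarrow> 'm \<Rightarrow> bool" where
  "epic A f \<longleftrightarrow> f \<in> Arr A \<and>
     (\<forall>W. \<forall>g\<in>Hom A (Cod A f) W. \<forall>h\<in>Hom A (Cod A f) W. g \<cdot>\<^bsub>A\<^esub> f = h \<cdot>\<^bsub>A\<^esub> f \<longrightarrow> g = h)"

definition isomorphic :: "('o, 'm) precategory \<Rightarrow> 'o \<Rightarrow> 'o \<Rightarrow> bool" where
  "isomorphic A X Y \<longleftrightarrow> X \<in> Obj A \<and> Y \<in> Obj A \<and>
     (\<exists>f\<in>Hom A X Y. \<exists>g\<in>Hom A Y X. g \<cdot>\<^bsub>A\<^esub> f = Ident A X \<and> f \<cdot>\<^bsub>A\<^esub> g = Ident A Y)"

definition is_kernel :: "('o, 'm) precategory \<Rightarrow> 'm \<Rightarrow> 'm \<Rightarrow> bool" where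
  "is_kernel A k f \<longleftrightarrow> k \<in> Arr A \<and> f \<in> Arr A \<and> Cod A k = Dom A f \<and>
     f \<cdot>\<^bsub>A\<^esub> k = Zero A (Dom A k) (Cod A f) \<and>
     (\<forall>W. \<forall>h\<in>Hom A W (Dom A f). f \<cdot>\<^bsub>A\<^esub> h = Zero A W (Cod A f) \<longrightarrow>
        (\<exists>!u. u \<in> Hom A W (Dom A k) \<and> k \<cdot>\<^bsub>A\<^esub> u = h))"

definition is_cokernel :: "('o, 'm) precategory \<Rightarrow> 'm \<Rightarrow> 'm \<Rightarrow> bool" where
  "is_cokernel A c f \<longleftrightarrow> c \<in> Arr A \<and> f \<in> Arr A \<and> Dom A c = Cod A f \<and>
     c \<cdot>\<^bsub>A\<^esub> f = Zero A (Dom A f) (Cod A c) \<and>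
     (\<forall>W. \<forall>h\<in>Hom A (Cod A f) W. h \<cdot>\<^bsub>A\<^esub> f = Zero A (Dom A f) W \<longrightarrow>
        (\<exists>!u. u \<in> Hom A (Cod A c) W \<and> u \<cdot>\<^bsub>A\<^esub> c = h))"

locale abelian_category = preadditive_category +
  assumes zero_object_exists: "\<exists>Z. zero_object A Z"
    and direct_sum_exists: "\<lbrakk>X \<in> Obj A; Y \<in> Obj A\<rbrakk> \<Longrightarrow> \<exists>S. direct_sum A X Y S"
    and kernel_exists: "f \<in> Arr A \<Longrightarrow> \<exists>k. is_kernel A k f"
    and cokernel_exists: "f \<in> Arr A \<Longrightarrow> \<exists>c. is_cokernel A c f"
    and monic_is_kernel: "monic A f \<Longrightarrow> \<exists>g. is_kernel A f g"
    and epic_is_cokernel: "epic A f \<Longrightarrow> \<exists>g. is_cokernel A f g"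


section \<open>Exact sequences\<close>

text \<open>
  Exactness of \<open>f\<close> followed by \<open>g\<close>: the image of \<open>f\<close>, i.e. the kernel of its cokernel,
  is a kernel of \<open>g\<close>.
\<close>

definition exact_at :: "('o, 'm) precategory \<Rightarrow> 'm \<Rightarrow> 'm \<Rightarrow> bool" where
  "exact_at A f g \<longleftrightarrow> f \<in> Arr A \<and> g \<in> Arr A \<and> Cod A f = Dom A g \<and>
     (\<exists>c k. is_cokernel A c f \<and> is_kernel A k c \<and> is_kernel A k g)"

definition exact_arrows :: "('o, 'm) precategory \<Rightarrow> 'm list \<Rightarrow> bool" where
  "exact_arrows A fs \<longleftrightarrow> set fs \<subseteq> Arr A \<and>
     (\<forall>i. Suc i < length fs \<longrightarrow> exact_at A (fs ! i) (fs ! Suc i))"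

definition short_exact ::
  "('o, 'm) precategory \<Rightarrow> 'o \<Rightarrow> 'm \<Rightarrow> 'o \<Rightarrow> 'm \<Rightarrow> 'o \<Rightarrow> bool" where
  "short_exact A X f Y g Z \<longleftrightarrow> f \<in> Hom A X Y \<and> g \<in> Hom A Y Z \<and>
     (\<exists>O1 O2. zero_object A O1 \<and> zero_object A O2 \<and>
        exact_arrows A [Zero A O1 X, f, g, Zero A Z O2])"


section \<open>Injective objects and Ext\<close>

definition injective_object :: "('o, 'm) precategory \<Rightarrow> 'o \<Rightarrow> bool" where
  "injective_object A I \<longleftrightarrow> I \<in> Obj A \<and>
     (\<forall>f. monic A f \<longrightarrow> (\<forall>g\<in>Hom A (Dom A f) I. \<exists>h\<in>Hom A (Cod A f) I. h \<cdot>\<^bsub>A\<^esub> f = g))"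

definition enough_injectives :: "('o, 'm) precategory \<Rightarrow> bool" where
  "enough_injectives A \<longleftrightarrow>
     (\<forall>M\<in>Obj A. \<exists>I. injective_object A I \<and> (\<exists>f\<in>Hom A M I. monic A f))"

text \<open>An exact sequence \<open>0 \<rightarrow> M \<rightarrow> I 0 \<rightarrow> I 1 \<rightarrow> \<dots>\<close> with injective \<open>I n\<close>.\<close>

definition injective_resolution ::
  "('o, 'm) precategory \<Rightarrow> 'o \<Rightarrow> (nat \<Rightarrow> 'o) \<Rightarrow> 'm \<Rightarrow> (nat \<Rightarrow> 'm) \<Rightarrow> bool" where
  "injective_resolution A M I e d \<longleftrightarrow>
     (\<forall>n. injective_object A (I n)) \<and> e \<in> Hom A M (I 0) \<and>
     (\<forall>n. d n \<in> Hom A (I n) (I (Suc n))) \<and>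
     (\<exists>Z. zero_object A Z \<and> exact_at A (Zero A Z M) e) \<and>
     exact_at A e (d 0) \<and> (\<forall>n. exact_at A (d n) (d (Suc n)))"

definition chosen_resolution ::
  "('o, 'm) precategory \<Rightarrow> 'o \<Rightarrow> (nat \<Rightarrow> 'o) \<times> (nat \<Rightarrow> 'm)" where
  "chosen_resolution A M = (SOME (I, d). \<exists>e. injective_resolution A M I e d)"

text \<open>
  Cocycles and coboundaries of the complex \<open>Hom X (I 0) \<rightarrow> Hom X (I 1) \<rightarrow> \<dots>\<close>, with zero in
  negative degrees.
\<close>

definition hom_cocycles ::
  "('o, 'm) precategory \<Rightarrow> 'o \<Rightarrow> (nat \<Rightarrow> 'o) \<Rightarrow> (nat \<Rightarrow> 'm) \<Rightarrow> nat \<Rightarrow> 'm set" where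
  "hom_cocycles A X I d n =
     kernel (hom_group A X (I n)) (hom_group A X (I (Suc n))) (\<lambda>f. d n \<cdot>\<^bsub>A\<^esub> f)"

definition hom_coboundaries ::
  "('o, 'm) precategory \<Rightarrow> 'o \<Rightarrow> (nat \<Rightarrow> 'o) \<Rightarrow> (nat \<Rightarrow> 'm) \<Rightarrow> nat \<Rightarrow> 'm set" where
  "hom_coboundaries A X I d n =
     (case n of 0 \<Rightarrow> {Zero A X (I 0)} | Suc m \<Rightarrow> (\<lambda>f. d m \<cdot>\<^bsub>A\<^esub> f) ` Hom A X (I m))"

text \<open>
  \<open>Ext\<^sup>n(X, M)\<close> as the \<open>n\<close>-th right derived functor of \<open>Hom X\<close> at \<open>M\<close>. It is meaningful when
  \<open>M\<close> has an injective resolution; in an abelian category with enough injectives every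
  object has one, and the choice affects the result only up to isomorphism.
\<close>

definition Ext :: "('o, 'm) precategory \<Rightarrow> nat \<Rightarrow> 'o \<Rightarrow> 'o \<Rightarrow> 'm set monoid" where
  "Ext A n X M =
     (let (I, d) = chosen_resolution A M in
       (hom_group A X (I n))\<lparr>carrier := hom_cocycles A X I d n\<rparr> Mod hom_coboundaries A X I d n)"

definition right_perp :: "('o, 'm) precategory \<Rightarrow> 'o set \<Rightarrow> 'o set" where
  "right_perp A \<X> = {M \<in> Obj A. \<forall>X\<in>\<X>. \<forall>n\<ge>1. trivial_group (Ext A n X M)}"


section \<open>Subcategories\<close>

text \<open>
  A full subcategory is given by its set of objects. \<open>subcategory\<close> includes the standing
  convention that subcategories are additive and closed under isomorphisms and direct summands.
\<close>

definition subcategory :: "('o, 'm) precategory \<Rightarrow> 'o set \<Rightarrow> bool" where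
  "subcategory A \<X> \<longleftrightarrow> \<X> \<subseteq> Obj A \<and>
     (\<forall>Z. zero_object A Z \<longrightarrow> Z \<in> \<X>) \<and>
     (\<forall>X Y S. direct_sum A X Y S \<longrightarrow> X \<in> \<X> \<longrightarrow> Y \<in> \<X> \<longrightarrow> S \<in> \<X>) \<and>
     (\<forall>X Y. isomorphic A X Y \<longrightarrow> X \<in> \<X> \<longrightarrow> Y \<in> \<X>) \<and>
     (\<forall>X Y S. direct_sum A X Y S \<longrightarrow> S \<in> \<X> \<longrightarrow> X \<in> \<X> \<and> Y \<in> \<X>)"

definition coresolving :: "('o, 'm) precategory \<Rightarrow> 'o set \<Rightarrow> bool" where
  "coresolving A \<T> \<longleftrightarrow> subcategory A \<T> \<and>
     (\<forall>I. injective_object A I \<longrightarrow> I \<in> \<T>) \<and>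
     (\<forall>X f Y g Z. short_exact A X f Y g Z \<longrightarrow> X \<in> \<T> \<longrightarrow> Z \<in> \<T> \<longrightarrow> Y \<in> \<T>) \<and>
     (\<forall>f c. monic A f \<longrightarrow> is_cokernel A c f \<longrightarrow> Dom A f \<in> \<T> \<longrightarrow> Cod A f \<in> \<T> \<longrightarrow> Cod A c \<in> \<T>)"

text \<open>
  The arguments of \<open>short_exact_sequence\<close> run from right to left: the last line below says that
  \<open>0 \<rightarrow> Hom E T' \<rightarrow> Hom E X \<rightarrow> Hom E T \<rightarrow> 0\<close> is exact.
\<close>

definition proper_generator :: "('o, 'm) precategory \<Rightarrow> 'o set \<Rightarrow> 'o set \<Rightarrow> 'o set \<Rightarrow> bool" where
  "proper_generator A \<E> \<C> \<T> \<longleftrightarrow> \<C> \<subseteq> \<T> \<and>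
     (\<forall>T\<in>\<T>. \<exists>T'\<in>\<T>. \<exists>X\<in>\<C>. \<exists>f g. short_exact A T' f X g T \<and>
        (\<forall>E\<in>\<E>. short_exact_sequence (hom_group A E T) (hom_group A E X) (hom_group A E T')
                  (\<lambda>h. g \<cdot>\<^bsub>A\<^esub> h) (\<lambda>h. f \<cdot>\<^bsub>A\<^esub> h)))"

text \<open>There is an exact sequence \<open>0 \<rightarrow> M \<rightarrow> X 0 \<rightarrow> \<dots> \<rightarrow> X n \<rightarrow> 0\<close> with all \<open>X i\<close> in \<open>\<X>\<close>.\<close>

definition has_coresolution :: "('o, 'm) precategory \<Rightarrow> 'o set \<Rightarrow> 'o \<Rightarrow> nat \<Rightarrow> bool" where
  "has_coresolution A \<X> M n \<longleftrightarrow>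
     (\<exists>X e d O1 O2. (\<forall>i\<le>n. X i \<in> \<X>) \<and> e \<in> Hom A M (X 0) \<and>
        (\<forall>i<n. d i \<in> Hom A (X i) (X (Suc i))) \<and> zero_object A O1 \<and> zero_object A O2 \<and>
        exact_arrows A ([Zero A O1 M, e] @ map d [0..<n] @ [Zero A (X n) O2]))"

definition rel_id :: "('o, 'm) precategory \<Rightarrow> 'o set \<Rightarrow> 'o \<Rightarrow> enat" where
  "rel_id A \<X> M = Inf {enat n | n. has_coresolution A \<X> M n}"

definition FID :: "('o, 'm) precategory \<Rightarrow> 'o set \<Rightarrow> enat" where
  "FID A \<X> = Sup {rel_id A \<X> M | M. M \<in> Obj A \<and> rel_id A \<X> M < \<infinity>}"

end

theory Submission
  imports Defs
begin


text \<open>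
  Splicing with the generator turns a \<open>\<T>\<close>-coresolution of \<open>M\<close> of length \<open>n\<close> into an exact
  sequence \<open>0 \<rightarrow> K \<rightarrow> M' \<rightarrow> M \<rightarrow> 0\<close> with \<open>K \<in> \<T>\<close> and \<open>\<C>-id M' \<le> n\<close>. Pushing a
  \<open>\<T>\<close>-coresolution of \<open>M'\<close> out along \<open>M' \<rightarrow> M\<close> gives \<open>\<T>-id M \<le> \<T>-id M'\<close>, so that
  \<open>\<T>-id M \<le> \<C>-id M' < \<infinity>\<close>; this is (1).

  If \<open>\<T> \<subseteq> \<C>\<^sup>\<bottom>\<close>, then \<open>Ext(-, K)\<close> vanishes in positive degrees on every object of finite
  \<open>\<C>\<close>-dimension. So for \<open>\<C>-id M < \<infinity>\<close> the sequence splits, and the retraction \<open>M' \<rightarrow> K\<close> extends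
  along \<open>M' \<rightarrow> X\<close>, where \<open>0 \<rightarrow> M' \<rightarrow> X \<rightarrow> N \<rightarrow> 0\<close> starts the \<open>\<C>\<close>-coresolution of \<open>M'\<close>. Hence
  \<open>Q = X / K\<close> is a direct summand of \<open>X\<close>, and \<open>0 \<rightarrow> M \<rightarrow> Q \<rightarrow> N \<rightarrow> 0\<close> starts a \<open>\<C>\<close>-coresolution
  of \<open>M\<close> of the same length.
\<close>

section \<open>Preadditive categories\<close>

lemma HomI: "\<lbrakk>f \<in> Arr A; Dom A f = X; Cod A f = Y\<rbrakk> \<Longrightarrow> f \<in> Hom A X Y"
  by (simp add: Hom_def)

lemma HomD:
  assumes "f \<in> Hom A X Y"
  shows "f \<in> Arr A" "Dom A f = X" "Cod A f = Y"
  using assms by (simp_all add: Hom_def)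

lemma is_kernel_Hom:
  assumes "is_kernel A k f" "f \<in> Hom A X Y"
  shows "k \<in> Hom A (Dom A k) X"
  using assms by (auto simp: is_kernel_def Hom_def)

lemma is_cokernel_Hom:
  assumes "is_cokernel A c f" "f \<in> Hom A X Y"
  shows "c \<in> Hom A Y (Cod A c)"
  using assms by (auto simp: is_cokernel_def Hom_def)

lemma is_kernel_zero:
  assumes "is_kernel A k f" "k \<in> Hom A K X" "f \<in> Hom A X Y"
  shows "f \<cdot>\<^bsub>A\<^esub> k = Zero A K Y"
  using assms by (auto simp: is_kernel_def Hom_def)

lemma is_cokernel_zero:
  assumes "is_cokernel A c f" "f \<in> Hom A X Y" "c \<in> Hom A Y Q"
  shows "c \<cdot>\<^bsub>A\<^esub> f = Zero A X Q"
  using assms by (auto simp: is_cokernel_def Hom_def)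

lemma is_kernel_factor:
  assumes "is_kernel A k f" "k \<in> Hom A K X" "f \<in> Hom A X Y"
    and "h \<in> Hom A W X" "f \<cdot>\<^bsub>A\<^esub> h = Zero A W Y"
  obtains u where "u \<in> Hom A W K" "k \<cdot>\<^bsub>A\<^esub> u = h"
proof -
  have "Dom A f = X" "Cod A f = Y" "Dom A k = K"
    using assms(2,3) by (simp_all add: Hom_def)
  then have "\<exists>u. u \<in> Hom A W K \<and> k \<cdot>\<^bsub>A\<^esub> u = h"
    using assms(1,4,5) unfolding is_kernel_def by blast
  then show ?thesis
    using that by blast
qed

lemma is_cokernel_factor:
  assumes "is_cokernel A c f" "f \<in> Hom A X Y" "c \<in> Hom A Y Q"
    and "h \<in> Hom A Y W" "h \<cdot>\<^bsub>A\<^esub> f = Zero A X W"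
  obtains u where "u \<in> Hom A Q W" "u \<cdot>\<^bsub>A\<^esub> c = h"
proof -
  have "Dom A f = X" "Cod A f = Y" "Cod A c = Q"
    using assms(2,3) by (simp_all add: Hom_def)
  then have "\<exists>u. u \<in> Hom A Q W \<and> u \<cdot>\<^bsub>A\<^esub> c = h"
    using assms(1,4,5) unfolding is_cokernel_def by blast
  then show ?thesis
    using that by blast
qed

lemma monic_cancel:
  assumes "monic A f" "f \<in> Hom A X Y" "g \<in> Hom A W X" "h \<in> Hom A W X"
    and "f \<cdot>\<^bsub>A\<^esub> g = f \<cdot>\<^bsub>A\<^esub> h"
  shows "g = h"
proof -
  have "Dom A f = X"
    using assms(2) by (simp add: Hom_def)
  then show ?thesis
    using assms(1,3,4,5) unfolding monic_def by blast
qed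

lemma epic_cancel:
  assumes "epic A f" "f \<in> Hom A X Y" "g \<in> Hom A Y W" "h \<in> Hom A Y W"
    and "g \<cdot>\<^bsub>A\<^esub> f = h \<cdot>\<^bsub>A\<^esub> f"
  shows "g = h"
proof -
  have "Cod A f = Y"
    using assms(2) by (simp add: Hom_def)
  then show ?thesis
    using assms(1,3,4,5) unfolding epic_def by blast
qed

text \<open>The opposite category serves to dualise: a fact about monics and kernels, instantiated
  at \<open>opp A\<close> and simplified with the rules below, becomes the fact about epics and
  cokernels in \<open>A\<close>.\<close>

definition opp :: "('o, 'm) precategory \<Rightarrow> ('o, 'm) precategory" where
  "opp A = \<lparr>Obj = Obj A, Arr = Arr A, Dom = Cod A, Cod = Dom A, Ident = Ident A,
     Comp = (\<lambda>g f. f \<cdot>\<^bsub>A\<^esub> g), Add = Add A, Zero = (\<lambda>X Y. Zero A Y X)\<rparr>"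

lemma opp_simps [simp]:
  "Obj (opp A) = Obj A" "Arr (opp A) = Arr A" "Dom (opp A) = Cod A" "Cod (opp A) = Dom A"
  "Ident (opp A) = Ident A" "Comp (opp A) g f = f \<cdot>\<^bsub>A\<^esub> g" "Add (opp A) = Add A"
  "Zero (opp A) X Y = Zero A Y X"
  by (simp_all add: opp_def)

lemma Hom_opp [simp]: "Hom (opp A) X Y = Hom A Y X"
  by (auto simp: Hom_def)

lemma hom_group_opp [simp]: "hom_group (opp A) X Y = hom_group A Y X"
  by (simp add: hom_group_def)

lemma monic_opp [simp]: "monic (opp A) f = epic A f"
  by (simp add: monic_def epic_def)

lemma epic_opp [simp]: "epic (opp A) f = monic A f"
  by (simp add: monic_def epic_def)

lemma is_kernel_opp [simp]: "is_kernel (opp A) k f = is_cokernel A k f"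
  by (auto simp: is_kernel_def is_cokernel_def)

lemma is_cokernel_opp [simp]: "is_cokernel (opp A) k f = is_kernel A k f"
  by (auto simp: is_kernel_def is_cokernel_def)

lemma zero_object_opp [simp]: "zero_object (opp A) Z = zero_object A Z"
  by (auto simp: zero_object_def)

lemma direct_sum_opp [simp]: "direct_sum (opp A) X Y S = direct_sum A X Y S"
proof -
  \<comment> \<open>Passing to \<open>opp A\<close> exchanges the injections with the
    projections.\<close>
  have "biproduct (opp A) X Y S i j p q = biproduct A X Y S p q i j" for i j p q
    by (auto simp: biproduct_def)
  then show ?thesis
    unfolding direct_sum_def by (metis opp_simps(1))
qed

context preadditive_category
begin

section \<open>Arithmetic in the hom-groups\<close>

lemma Hom_Obj:
  assumes "f \<in> Hom A X Y"
  shows "X \<in> Obj A" "Y \<in> Obj A"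
  using assms Dom_in_Obj Cod_in_Obj by (auto simp: Hom_def)

lemma Zero_in_Hom: "\<lbrakk>X \<in> Obj A; Y \<in> Obj A\<rbrakk> \<Longrightarrow> Zero A X Y \<in> Hom A X Y"
  using comm_group.axioms(2)[OF hom_comm_group] group.is_monoid monoid.one_closed
  by (fastforce simp: hom_group_def)

lemma Add_in_Hom: "\<lbrakk>f \<in> Hom A X Y; g \<in> Hom A X Y\<rbrakk> \<Longrightarrow> Add A f g \<in> Hom A X Y"
proof -
  assume f: "f \<in> Hom A X Y" and g: "g \<in> Hom A X Y"
  interpret comm_group "hom_group A X Y"
    using hom_comm_group Hom_Obj[OF f] .
  show ?thesis
    using m_closed f g by (simp add: hom_group_def)
qed

lemma Add_comm: "\<lbrakk>f \<in> Hom A X Y; g \<in> Hom A X Y\<rbrakk> \<Longrightarrow> Add A f g = Add A g f"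
proof -
  assume f: "f \<in> Hom A X Y" and g: "g \<in> Hom A X Y"
  interpret comm_group "hom_group A X Y"
    using hom_comm_group Hom_Obj[OF f] .
  show ?thesis
    using m_comm f g by (simp add: hom_group_def)
qed

lemma Zero_Add: "f \<in> Hom A X Y \<Longrightarrow> Add A (Zero A X Y) f = f"
proof -
  assume f: "f \<in> Hom A X Y"
  interpret comm_group "hom_group A X Y"
    using hom_comm_group Hom_Obj[OF f] .
  show ?thesis
    using l_one f by (simp add: hom_group_def)
qed

lemma Add_Zero: "f \<in> Hom A X Y \<Longrightarrow> Add A f (Zero A X Y) = f"
  using Zero_Add Add_comm Zero_in_Hom Hom_Obj by metis

lemma Add_cancel_right:
  assumes "f \<in> Hom A X Y" "g \<in> Hom A X Y" "h \<in> Hom A X Y" "Add A f h = Add A g h"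
  shows "f = g"
proof -
  interpret comm_group "hom_group A X Y"
    using hom_comm_group Hom_Obj[OF assms(1)] .
  show ?thesis
    using right_cancel[of h f g] assms by (simp add: hom_group_def)
qed

lemma Add_eq_right:
  assumes "f \<in> Hom A X Y" "h \<in> Hom A X Y" "Add A f h = h"
  shows "f = Zero A X Y"
  using Add_cancel_right[OF assms(1) Zero_in_Hom assms(2)] Zero_Add assms Hom_Obj by metis

text \<open>The record has no negation, so the difference \<open>f - g\<close> enters later
  arguments as an arrow \<open>d\<close> characterised by its sum with \<open>g\<close>.\<close>

lemma difference:
  assumes "f \<in> Hom A X Y" "g \<in> Hom A X Y"
  obtains d where "d \<in> Hom A X Y" "Add A d g = f"
proof -
  interpret comm_group "hom_group A X Y"
    using hom_comm_group Hom_Obj[OF assms(1)] .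
  let ?d = "f \<otimes>\<^bsub>hom_group A X Y\<^esub> inv\<^bsub>hom_group A X Y\<^esub> g"
  have fg: "f \<in> carrier (hom_group A X Y)" "g \<in> carrier (hom_group A X Y)"
    using assms by (simp_all add: hom_group_def)
  then have "?d \<in> carrier (hom_group A X Y)" "?d \<otimes>\<^bsub>hom_group A X Y\<^esub> g = f"
    by (simp_all add: m_assoc)
  then show ?thesis
    using that by (simp add: hom_group_def)
qed

text \<open>By bilinearity the composite equals its own double, so cancellation makes it
  zero.\<close>

lemma Comp_Zero:
  assumes "g \<in> Hom A Y Z" "X \<in> Obj A"
  shows "g \<cdot> Zero A X Y = Zero A X Z"
proof -
  have z: "Zero A X Y \<in> Hom A X Y"
    using Zero_in_Hom assms Hom_Obj by blast
  have "Add A (g \<cdot> Zero A X Y) (g \<cdot> Zero A X Y) = g \<cdot> Zero A X Y"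
    using Comp_Add[OF z z assms(1)] Zero_Add[OF z] by simp
  then show ?thesis
    using Add_eq_right Comp_in_Hom[OF z assms(1)] by blast
qed

lemma Zero_Comp:
  assumes "f \<in> Hom A X Y" "Z \<in> Obj A"
  shows "Zero A Y Z \<cdot> f = Zero A X Z"
proof -
  have z: "Zero A Y Z \<in> Hom A Y Z"
    using Zero_in_Hom assms Hom_Obj by blast
  have "Add A (Zero A Y Z \<cdot> f) (Zero A Y Z \<cdot> f) = Zero A Y Z \<cdot> f"
    using Add_Comp[OF assms(1) z z] Zero_Add[OF z] by simp
  then show ?thesis
    using Add_eq_right Comp_in_Hom[OF assms(1) z] by blast
qed

section \<open>Monics, kernels and their duals\<close>

lemma monicI:
  assumes f: "f \<in> Hom A X Y"
    and zero: "\<And>W h. \<lbrakk>h \<in> Hom A W X; f \<cdot> h = Zero A W Y\<rbrakk> \<Longrightarrow> h = Zero A W X"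
  shows "monic A f"
  unfolding monic_def HomD(2)[OF f]
proof (intro conjI allI ballI impI)
  show "f \<in> Arr A"
    using HomD[OF f] by simp
  fix W g h
  assume g: "g \<in> Hom A W X" and h: "h \<in> Hom A W X" and eq: "f \<cdot> g = f \<cdot> h"
  obtain d where d: "d \<in> Hom A W X" "Add A d h = g"
    using difference[OF g h] .
  have "Add A (f \<cdot> d) (f \<cdot> h) = f \<cdot> h"
    using Comp_Add[OF d(1) h f] d(2) eq by simp
  then have "d = Zero A W X"
    using zero[OF d(1)] Add_eq_right Comp_in_Hom[OF d(1) f] Comp_in_Hom[OF h f] by blast
  then show "g = h"
    using d(2) Zero_Add[OF h] by simp
qed

lemma monic_zero:
  assumes "monic A f" "f \<in> Hom A X Y" "h \<in> Hom A W X" "f \<cdot> h = Zero A W Y"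
  shows "h = Zero A W X"
proof -
  have "W \<in> Obj A" "X \<in> Obj A"
    using assms(3) Hom_Obj by auto
  then show ?thesis
    using monic_cancel[OF assms(1-3) Zero_in_Hom] Comp_Zero[OF assms(2)] assms(4) by simp
qed

lemma kernel_monic:
  assumes "is_kernel A k f"
  shows "monic A k"
proof -
  have k: "k \<in> Hom A (Dom A k) (Dom A f)" and f: "f \<in> Hom A (Dom A f) (Cod A f)"
    using assms by (auto simp: is_kernel_def Hom_def)
  show ?thesis
    unfolding monic_def
  proof (intro conjI allI ballI impI)
    show "k \<in> Arr A"
      using HomD[OF k] by simp
    fix W g h
    assume g: "g \<in> Hom A W (Dom A k)" and h: "h \<in> Hom A W (Dom A k)" and eq: "k \<cdot> g = k \<cdot> h"
    have kg: "k \<cdot> g \<in> Hom A W (Dom A f)"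
      using Comp_in_Hom[OF g k] .
    have "f \<cdot> (k \<cdot> g) = (f \<cdot> k) \<cdot> g"
      using Comp_assoc[OF g k f] by simp
    also have "\<dots> = Zero A W (Cod A f)"
      using is_kernel_zero[OF assms k f] Zero_Comp[OF g] Hom_Obj[OF f] by simp
    finally have "\<exists>!u. u \<in> Hom A W (Dom A k) \<and> k \<cdot> u = k \<cdot> g"
      using assms kg unfolding is_kernel_def by blast
    then show "g = h"
      using g h eq by metis
  qed
qed

text \<open>Monicity of \<open>k\<close> gives the uniqueness of factorisations, so only their
  existence is left to check.\<close>

lemma is_kernelI:
  assumes k: "k \<in> Hom A K X" and f: "f \<in> Hom A X Y" and "f \<cdot> k = Zero A K Y" "monic A k"
    and ex: "\<And>W h. \<lbrakk>h \<in> Hom A W X; f \<cdot> h = Zero A W Y\<rbrakk> \<Longrightarrow> \<exists>u\<in>Hom A W K. k \<cdot> u = h"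
  shows "is_kernel A k f"
  unfolding is_kernel_def HomD(2,3)[OF k] HomD(2,3)[OF f]
proof (intro conjI allI ballI impI)
  fix W h
  assume h: "h \<in> Hom A W X" and z: "f \<cdot> h = Zero A W Y"
  show "\<exists>!u. u \<in> Hom A W K \<and> k \<cdot> u = h"
    using ex[OF h z] monic_cancel[OF assms(4) k] by metis
qed (use assms HomD(1)[OF k] HomD(1)[OF f] in auto)

lemma monic_Comp:
  assumes "monic A f" "f \<in> Hom A X Y" "monic A g" "g \<in> Hom A Y Z"
  shows "monic A (g \<cdot> f)"
proof (rule monicI)
  show "g \<cdot> f \<in> Hom A X Z"
    using Comp_in_Hom assms by blast
  fix W h
  assume h: "h \<in> Hom A W X" and "(g \<cdot> f) \<cdot> h = Zero A W Z"
  then have "g \<cdot> (f \<cdot> h) = Zero A W Z"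
    using Comp_assoc[OF h assms(2,4)] by simp
  then have "f \<cdot> h = Zero A W Y"
    using monic_zero[OF assms(3,4) Comp_in_Hom[OF h assms(2)]] by simp
  then show "h = Zero A W X"
    using monic_zero[OF assms(1,2) h] by simp
qed

text \<open>The arrows killed by \<open>m \<cdot> f\<close> are exactly those killed by
  \<open>f\<close>, and being a kernel depends on the second arrow only through them.\<close>

lemma is_kernel_Comp_monic:
  assumes k: "k \<in> Hom A K X" and f: "f \<in> Hom A X Y" and m: "m \<in> Hom A Y Z" "monic A m"
  shows "is_kernel A k (m \<cdot> f) \<longleftrightarrow> is_kernel A k f"
proof -
  have mf: "m \<cdot> f \<in> Hom A X Z"
    using Comp_in_Hom f m by blast
  have eq: "(m \<cdot> f) \<cdot> h = Zero A W Z \<longleftrightarrow> f \<cdot> h = Zero A W Y" if h: "h \<in> Hom A W X" for h W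
    unfolding Comp_assoc[OF h f m(1)]
    using monic_zero[OF m(2,1) Comp_in_Hom[OF h f]] Comp_Zero[OF m(1) Hom_Obj(1)[OF h]] by metis
  \<comment> \<open>\<open>P\<close> stands for the unique-factorisation clause of
    \<open>is_kernel\<close>, in which the two conditions can then be exchanged.\<close>
  have "(\<forall>W. \<forall>h\<in>Hom A W X. (m \<cdot> f) \<cdot> h = Zero A W Z \<longrightarrow> P W h) \<longleftrightarrow>
    (\<forall>W. \<forall>h\<in>Hom A W X. f \<cdot> h = Zero A W Y \<longrightarrow> P W h)" for P
    using eq by blast
  then show ?thesis
    unfolding is_kernel_def HomD(2,3)[OF k] HomD(2,3)[OF f] HomD(2,3)[OF mf] eq[OF k]
    by (simp add: HomD(1)[OF k] HomD(1)[OF f] HomD(1)[OF mf])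
qed

lemma opp_preadditive_category: "preadditive_category (opp A)"
  by (intro preadditive_category.intro)
    (simp_all add: Dom_in_Obj Cod_in_Obj Ident_in_Hom Comp_in_Hom Comp_Ident Ident_Comp Comp_assoc
      hom_comm_group Comp_Add Add_Comp)

lemmas epicI = preadditive_category.monicI[OF opp_preadditive_category, simplified]
lemmas epic_zero = preadditive_category.monic_zero[OF opp_preadditive_category, simplified]
lemmas cokernel_epic = preadditive_category.kernel_monic[OF opp_preadditive_category, simplified]
lemmas is_cokernelI = preadditive_category.is_kernelI[OF opp_preadditive_category, simplified]
lemmas epic_Comp = preadditive_category.monic_Comp[OF opp_preadditive_category, simplified]
lemmas is_cokernel_Comp_epic =
  preadditive_category.is_kernel_Comp_monic[OF opp_preadditive_category, simplified]

end


section \<open>Short exact sequences\<close>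

text \<open>A kernel-cokernel pair: this form is visibly self-dual and mentions neither images nor
  zero objects. Its agreement with \<open>short_exact\<close> is
  \<open>short_exact_iff_ses\<close>.\<close>

definition ses :: "('o, 'm) precategory \<Rightarrow> 'o \<Rightarrow> 'm \<Rightarrow> 'o \<Rightarrow> 'm \<Rightarrow> 'o \<Rightarrow> bool" where
  "ses A X f Y g Z \<longleftrightarrow>
     f \<in> Hom A X Y \<and> g \<in> Hom A Y Z \<and> is_kernel A f g \<and> is_cokernel A g f"

lemma sesD:
  assumes "ses A X f Y g Z"
  shows "f \<in> Hom A X Y" "g \<in> Hom A Y Z" "is_kernel A f g" "is_cokernel A g f"
  using assms by (simp_all add: ses_def)

lemma ses_opp [simp]: "ses (opp A) X f Y g Z = ses A Z g Y f X"
  by (auto simp: ses_def)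

lemma ses_zero: "ses A X f Y g Z \<Longrightarrow> g \<cdot>\<^bsub>A\<^esub> f = Zero A X Z"
  using is_kernel_zero sesD by metis

context abelian_category
begin

lemma kernel_Hom_exists:
  assumes "f \<in> Hom A X Y"
  obtains K k where "k \<in> Hom A K X" "is_kernel A k f"
  using kernel_exists[of f] is_kernel_Hom[OF _ assms] HomD[OF assms] by blast

lemma cokernel_Hom_exists:
  assumes "f \<in> Hom A X Y"
  obtains Q c where "c \<in> Hom A Y Q" "is_cokernel A c f"
  using cokernel_exists[of f] is_cokernel_Hom[OF _ assms] HomD[OF assms] by blast

lemma opp_abelian_category: "abelian_category (opp A)"
proof (intro abelian_category.intro abelian_category_axioms.intro)
  show "preadditive_category (opp A)"
    by (rule opp_preadditive_category)
qed (simp_all add: zero_object_exists direct_sum_exists kernel_exists cokernel_exists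
    monic_is_kernel epic_is_cokernel)

text \<open>A monic is a kernel of some \<open>g\<close>, and \<open>g\<close> factors through the
  cokernel \<open>c\<close>. Hence whatever \<open>c\<close> kills is killed by \<open>g\<close> and
  factors through \<open>f\<close>.\<close>

lemma monic_is_kernel_of_cokernel:
  assumes "monic A f" and f: "f \<in> Hom A X Y" and c: "c \<in> Hom A Y Q" "is_cokernel A c f"
  shows "is_kernel A f c"
proof -
  obtain g where g: "is_kernel A f g"
    using monic_is_kernel assms(1) by blast
  then have gh: "g \<in> Hom A Y (Cod A g)"
    using HomD[OF f] by (auto simp: is_kernel_def Hom_def)
  have "g \<cdot> f = Zero A X (Cod A g)"
    using is_kernel_zero[OF g f gh] .
  then obtain v where v: "v \<in> Hom A Q (Cod A g)" "v \<cdot> c = g"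
    using is_cokernel_factor[OF c(2) f c(1) gh] by blast
  show ?thesis
  proof (rule is_kernelI[OF f c(1)])
    show "c \<cdot> f = Zero A X Q"
      using is_cokernel_zero[OF c(2) f c(1)] .
    show "monic A f"
      by fact
    fix W h
    assume h: "h \<in> Hom A W Y" and z: "c \<cdot> h = Zero A W Q"
    have "g \<cdot> h = v \<cdot> (c \<cdot> h)"
      using Comp_assoc[OF h c(1) v(1)] v(2) by simp
    also have "\<dots> = Zero A W (Cod A g)"
      using z Comp_Zero[OF v(1)] Hom_Obj[OF h] by simp
    finally show "\<exists>u\<in>Hom A W X. f \<cdot> u = h"
      using is_kernel_factor[OF g f gh h] by blast
  qed
qed

lemmas epic_is_cokernel_of_kernel =
  abelian_category.monic_is_kernel_of_cokernel[OF opp_abelian_category, simplified]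

lemma ses_monicI:
  "\<lbrakk>monic A f; f \<in> Hom A X Y; g \<in> Hom A Y Z; is_cokernel A g f\<rbrakk> \<Longrightarrow> ses A X f Y g Z"
  by (simp add: ses_def monic_is_kernel_of_cokernel)

lemma ses_epicI:
  "\<lbrakk>epic A g; f \<in> Hom A X Y; g \<in> Hom A Y Z; is_kernel A f g\<rbrakk> \<Longrightarrow> ses A X f Y g Z"
  by (simp add: ses_def epic_is_cokernel_of_kernel)

lemma epic_ses:
  assumes "epic A g" "g \<in> Hom A Y Z"
  obtains X f where "ses A X f Y g Z"
  using kernel_Hom_exists[OF assms(2)] ses_epicI[OF assms(1) _ assms(2)] by metis

lemma ses_monic_epic:
  assumes "ses A X f Y g Z"
  shows "monic A f" "epic A g"
  using assms kernel_monic cokernel_epic by (auto simp: ses_def)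

text \<open>Let \<open>m\<close> kill \<open>h\<close> and let \<open>q\<close> be the cokernel of
  \<open>h\<close>, so that \<open>m\<close> factors through \<open>q\<close>. The epic
  \<open>q \<cdot> c\<close> is the cokernel of its kernel \<open>t\<close>. Since \<open>f\<close>
  kills \<open>t\<close>, so does \<open>c\<close>, and \<open>c\<close> factors through
  \<open>q \<cdot> c\<close>. This gives \<open>q\<close> a left inverse, and
  \<open>q \<cdot> h = 0\<close> forces \<open>h = 0\<close>.\<close>

lemma coimage_factor_monic:
  assumes f: "f \<in> Hom A X Y" and k: "k \<in> Hom A K X" "is_kernel A k f"
    and c: "c \<in> Hom A X C" "is_cokernel A c k" and m: "m \<in> Hom A C Y" "m \<cdot> c = f"
  shows "monic A m"
proof (rule monicI[OF m(1)])
  fix W h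
  assume h: "h \<in> Hom A W C" and z: "m \<cdot> h = Zero A W Y"
  obtain Q q where q: "q \<in> Hom A C Q" "is_cokernel A q h"
    using cokernel_Hom_exists[OF h] .
  obtain m' where m': "m' \<in> Hom A Q Y" "m' \<cdot> q = m"
    using is_cokernel_factor[OF q(2) h q(1) m(1) z] .
  have qc: "q \<cdot> c \<in> Hom A X Q" "epic A (q \<cdot> c)"
    using Comp_in_Hom[OF c(1) q(1)] epic_Comp cokernel_epic[OF q(2)] cokernel_epic[OF c(2)] c(1) q(1)
    by blast+
  obtain t T where t: "t \<in> Hom A T X" "is_kernel A t (q \<cdot> c)"
    using kernel_Hom_exists[OF qc(1)] .
  have tc: "is_cokernel A (q \<cdot> c) t"
    using epic_is_cokernel_of_kernel[OF qc(2,1) t] .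
  have "f \<cdot> t = m' \<cdot> ((q \<cdot> c) \<cdot> t)"
    using Comp_assoc[OF t(1) qc(1) m'(1)] Comp_assoc[OF c(1) q(1) m'(1)] m'(2) m(2) by simp
  also have "\<dots> = Zero A T Y"
    using is_kernel_zero[OF t(2,1) qc(1)] Comp_Zero[OF m'(1)] Hom_Obj[OF t(1)] by simp
  finally obtain s where s: "s \<in> Hom A T K" "k \<cdot> s = t"
    using is_kernel_factor[OF k(2,1) f t(1)] by blast
  have "c \<cdot> t = (c \<cdot> k) \<cdot> s"
    using Comp_assoc[OF s(1) k(1) c(1)] s(2) by simp
  also have "\<dots> = Zero A T C"
    using is_cokernel_zero[OF c(2) k(1) c(1)] Zero_Comp[OF s(1)] Hom_Obj[OF c(1)] by simp
  finally obtain v where v: "v \<in> Hom A Q C" "v \<cdot> (q \<cdot> c) = c"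
    using is_cokernel_factor[OF tc t(1) qc(1) c(1)] by blast
  have "(v \<cdot> q) \<cdot> c = Ident A C \<cdot> c"
    using v Comp_assoc[OF c(1) q(1) v(1)] Ident_Comp[OF c(1)] by simp
  then have vq: "v \<cdot> q = Ident A C"
    using epic_cancel[OF cokernel_epic[OF c(2)] c(1) Comp_in_Hom[OF q(1) v(1)] Ident_in_Hom]
      Hom_Obj[OF c(1)] by blast
  have "h = v \<cdot> (q \<cdot> h)"
    using Comp_assoc[OF h q(1) v(1)] vq Ident_Comp[OF h] by simp
  also have "\<dots> = Zero A W C"
    using is_cokernel_zero[OF q(2) h q(1)] Comp_Zero[OF v(1)] Hom_Obj[OF h] by simp
  finally show "h = Zero A W C" .
qed

section \<open>Exactness expressed by monics, epics and kernels\<close>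

lemma zero_object_Hom_eq:
  assumes "zero_object A Z" "f \<in> Hom A Z X" "g \<in> Hom A Z X"
  shows "f = g"
  using assms Hom_Obj(2)[OF assms(2)] unfolding zero_object_def by blast

text \<open>The identity of \<open>X\<close> is a cokernel of the arrow from the zero object, so the
  image of that arrow is zero. Exactness therefore says that \<open>f\<close> has zero
  kernel.\<close>

lemma exact_at_zero_left_iff:
  assumes Z: "zero_object A Z" and f: "f \<in> Hom A X Y"
  shows "exact_at A (Zero A Z X) f \<longleftrightarrow> monic A f"
proof -
  have X: "X \<in> Obj A" and ZO: "Z \<in> Obj A"
    using Hom_Obj[OF f] Z by (auto simp: zero_object_def)
  have z: "Zero A Z X \<in> Hom A Z X"
    using Zero_in_Hom X ZO by blast
  have i: "Ident A X \<in> Hom A X X"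
    using Ident_in_Hom X .
  show ?thesis
  proof
    assume "exact_at A (Zero A Z X) f"
    then obtain c k where c: "is_cokernel A c (Zero A Z X)" and kc: "is_kernel A k c"
      and kf: "is_kernel A k f"
      unfolding exact_at_def by blast
    obtain K Q where ch: "c \<in> Hom A X Q" and kh: "k \<in> Hom A K X"
      using is_cokernel_Hom[OF c z] is_kernel_Hom[OF kf f] by blast
    obtain u where u: "u \<in> Hom A Q X" "u \<cdot> c = Ident A X"
      using is_cokernel_factor[OF c z ch i] Comp_Zero[OF i ZO] by blast
    have "k = u \<cdot> (c \<cdot> k)"
      using Comp_assoc[OF kh ch u(1)] u(2) Ident_Comp[OF kh] by simp
    also have "\<dots> = Zero A K X"
      using is_kernel_zero[OF kc kh ch] Comp_Zero[OF u(1)] Hom_Obj[OF kh] by simp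
    finally have k0: "k = Zero A K X" .
    show "monic A f"
    proof (rule monicI[OF f])
      fix W h
      assume h: "h \<in> Hom A W X" "f \<cdot> h = Zero A W Y"
      obtain w where w: "w \<in> Hom A W K" "k \<cdot> w = h"
        using is_kernel_factor[OF kf kh f h] .
      then show "h = Zero A W X"
        using k0 Zero_Comp[OF w(1) X] by simp
    qed
  next
    assume m: "monic A f"
    have ker: "is_kernel A (Zero A Z X) g" if g: "g \<in> Hom A X V" and mg: "monic A g" for g V
    proof (rule is_kernelI[OF z g])
      show "g \<cdot> Zero A Z X = Zero A Z V"
        using Comp_Zero[OF g ZO] .
      show "monic A (Zero A Z X)"
        unfolding monic_def HomD(2)[OF z]
      proof (intro conjI allI ballI impI)
        fix W g h assume "g \<in> Hom A W Z" "h \<in> Hom A W Z"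
        then show "g = h"
          using Z Hom_Obj(1) unfolding zero_object_def by blast
      qed (use HomD[OF z] in simp)
      fix W h
      assume h: "h \<in> Hom A W X" "g \<cdot> h = Zero A W V"
      have W: "W \<in> Obj A"
        using Hom_Obj[OF h(1)] by simp
      have wz: "Zero A W Z \<in> Hom A W Z"
        using Zero_in_Hom W ZO .
      show "\<exists>u\<in>Hom A W Z. Zero A Z X \<cdot> u = h"
        using monic_zero[OF mg g h] Zero_Comp[OF wz X] wz by auto
    qed
    have mi: "monic A (Ident A X)"
      using monicI[OF i] Ident_Comp by metis
    have "is_cokernel A (Ident A X) (Zero A Z X)"
    proof (rule is_cokernelI[OF i z])
      show "Ident A X \<cdot> Zero A Z X = Zero A Z X"
        using Ident_Comp[OF z] .
      show "epic A (Ident A X)"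
        using epicI[OF i] Comp_Ident by metis
      fix W h
      assume "h \<in> Hom A X W"
      then show "\<exists>u\<in>Hom A X W. u \<cdot> Ident A X = h"
        using Comp_Ident by blast
    qed
    then show "exact_at A (Zero A Z X) f"
      unfolding exact_at_def using ker[OF i mi] ker[OF f m] HomD[OF z] HomD[OF f] by auto
  qed
qed

text \<open>\<open>exact_at\<close> is not symmetric in form under \<open>opp\<close>, so the dual
  is argued directly: the identity is a kernel of the arrow to zero, hence exactness says that the
  cokernel of \<open>g\<close> is zero.\<close>

lemma exact_at_zero_right_iff:
  assumes Z: "zero_object A Z" and g: "g \<in> Hom A Y X"
  shows "exact_at A g (Zero A X Z) \<longleftrightarrow> epic A g"
proof -
  have X: "X \<in> Obj A" and ZO: "Z \<in> Obj A"
    using Hom_Obj[OF g] Z by (auto simp: zero_object_def)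
  have z: "Zero A X Z \<in> Hom A X Z"
    using Zero_in_Hom X ZO by blast
  have i: "Ident A X \<in> Hom A X X"
    using Ident_in_Hom X .
  show ?thesis
  proof
    assume "exact_at A g (Zero A X Z)"
    then obtain c k where c: "is_cokernel A c g" and kc: "is_kernel A k c"
      and kz: "is_kernel A k (Zero A X Z)"
      unfolding exact_at_def by blast
    obtain K Q where ch: "c \<in> Hom A X Q" and kh: "k \<in> Hom A K X"
      using is_cokernel_Hom[OF c g] is_kernel_Hom[OF kz z] by blast
    obtain u where u: "u \<in> Hom A X K" "k \<cdot> u = Ident A X"
      using is_kernel_factor[OF kz kh z i] Zero_Comp[OF i ZO] by blast
    have Q: "Q \<in> Obj A"
      using Hom_Obj[OF ch] by simp
    have "c = (c \<cdot> k) \<cdot> u"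
      using Comp_assoc[OF u(1) kh ch] u(2) Comp_Ident[OF ch] by simp
    also have "\<dots> = Zero A X Q"
      using is_kernel_zero[OF kc kh ch] Zero_Comp[OF u(1) Q] by simp
    finally have c0: "c = Zero A X Q" .
    show "epic A g"
    proof (rule epicI[OF g])
      fix W h
      assume h: "h \<in> Hom A X W" "h \<cdot> g = Zero A Y W"
      obtain w where w: "w \<in> Hom A Q W" "w \<cdot> c = h"
        using is_cokernel_factor[OF c g ch h] .
      then show "h = Zero A X W"
        using c0 Comp_Zero[OF w(1) X] by simp
    qed
  next
    assume e: "epic A g"
    have "is_cokernel A (Zero A X Z) g"
    proof (rule is_cokernelI[OF z g])
      show "Zero A X Z \<cdot> g = Zero A Y Z"
        using Zero_Comp[OF g ZO] .
      show "epic A (Zero A X Z)"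
        unfolding epic_def HomD(3)[OF z]
      proof (intro conjI allI ballI impI)
        fix W g h assume "g \<in> Hom A Z W" "h \<in> Hom A Z W"
        then show "g = h"
          using zero_object_Hom_eq[OF Z] by blast
      qed (use HomD[OF z] in simp)
      fix W h
      assume h: "h \<in> Hom A X W" "h \<cdot> g = Zero A Y W"
      have W: "W \<in> Obj A"
        using Hom_Obj[OF h(1)] by simp
      have wz: "Zero A Z W \<in> Hom A Z W"
        using Zero_in_Hom ZO W .
      show "\<exists>u\<in>Hom A Z W. u \<cdot> Zero A X Z = h"
        using epic_zero[OF e g h] Comp_Zero[OF wz X] wz by auto
    qed
    moreover have "is_kernel A (Ident A X) (Zero A X Z)"
    proof (rule is_kernelI[OF i z])
      show "Zero A X Z \<cdot> Ident A X = Zero A X Z"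
        using Comp_Ident[OF z] .
      show "monic A (Ident A X)"
        using monicI[OF i] Ident_Comp by metis
      fix W h
      assume "h \<in> Hom A W X"
      then show "\<exists>u\<in>Hom A W X. Ident A X \<cdot> u = h"
        using Ident_Comp by blast
    qed
    ultimately show "exact_at A g (Zero A X Z)"
      unfolding exact_at_def using HomD[OF z] HomD[OF g] by auto
  qed
qed

lemma exact_at_zero:
  assumes "exact_at A f g" and f: "f \<in> Hom A X Y" and g: "g \<in> Hom A Y Z"
  shows "g \<cdot> f = Zero A X Z"
proof -
  obtain c k where c: "is_cokernel A c f" and kc: "is_kernel A k c" and kg: "is_kernel A k g"
    using assms(1) unfolding exact_at_def by blast
  obtain K Q where ch: "c \<in> Hom A Y Q" and kh: "k \<in> Hom A K Y"
    using is_cokernel_Hom[OF c f] is_kernel_Hom[OF kg g] by blast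
  obtain u where u: "u \<in> Hom A X K" "k \<cdot> u = f"
    using is_kernel_factor[OF kc kh ch f is_cokernel_zero[OF c f ch]] .
  have Z: "Z \<in> Obj A"
    using Hom_Obj[OF g] by simp
  have "g \<cdot> f = (g \<cdot> k) \<cdot> u"
    using Comp_assoc[OF u(1) kh g] u(2) by simp
  also have "\<dots> = Zero A X Z"
    using is_kernel_zero[OF kg kh g] Zero_Comp[OF u(1) Z] by simp
  finally show ?thesis .
qed

text \<open>A monic is a kernel of its own cokernel, so it is its own image.\<close>

lemma exact_at_monic_iff:
  assumes m: "monic A f" and f: "f \<in> Hom A X Y" and g: "g \<in> Hom A Y Z"
  shows "exact_at A f g \<longleftrightarrow> is_kernel A f g"
proof
  assume ex: "exact_at A f g"
  obtain c k where c: "is_cokernel A c f" and kc: "is_kernel A k c" and kg: "is_kernel A k g"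
    using ex unfolding exact_at_def by blast
  obtain K Q where ch: "c \<in> Hom A Y Q" and kh: "k \<in> Hom A K Y"
    using is_cokernel_Hom[OF c f] is_kernel_Hom[OF kg g] by blast
  have fc: "is_kernel A f c"
    using monic_is_kernel_of_cokernel[OF m f ch c] .
  show "is_kernel A f g"
  proof (rule is_kernelI[OF f g exact_at_zero[OF ex f g] m])
    fix W h
    assume h: "h \<in> Hom A W Y" "g \<cdot> h = Zero A W Z"
    obtain v where v: "v \<in> Hom A W K" "k \<cdot> v = h"
      using is_kernel_factor[OF kg kh g h] .
    have Q: "Q \<in> Obj A"
      using Hom_Obj[OF ch] by simp
    have "c \<cdot> h = (c \<cdot> k) \<cdot> v"
      using Comp_assoc[OF v(1) kh ch] v(2) by simp
    also have "\<dots> = Zero A W Q"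
      using is_kernel_zero[OF kc kh ch] Zero_Comp[OF v(1) Q] by simp
    finally show "\<exists>u\<in>Hom A W X. f \<cdot> u = h"
      using is_kernel_factor[OF fc f ch h(1)] by blast
  qed
next
  assume k: "is_kernel A f g"
  obtain Q c where c: "c \<in> Hom A Y Q" "is_cokernel A c f"
    using cokernel_Hom_exists[OF f] .
  then show "exact_at A f g"
    unfolding exact_at_def
    using k monic_is_kernel_of_cokernel[OF m f c] HomD[OF f] HomD[OF g] by auto
qed

text \<open>Exactness sees the first arrow only through its cokernels, and these do not change when
  an epic is composed in front.\<close>

lemma exact_at_Comp_epic_iff:
  assumes e: "e \<in> Hom A W X" "epic A e" and f: "f \<in> Hom A X Y"
  shows "exact_at A (f \<cdot> e) g \<longleftrightarrow> exact_at A f g"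
proof -
  have fe: "f \<cdot> e \<in> Hom A W Y"
    using Comp_in_Hom e f by blast
  have "is_cokernel A c (f \<cdot> e) \<longleftrightarrow> is_cokernel A c f" for c
  proof -
    have "c \<in> Hom A Y (Cod A c)" if "is_cokernel A c (f \<cdot> e) \<or> is_cokernel A c f"
      using that is_cokernel_Hom[OF _ fe] is_cokernel_Hom[OF _ f] by blast
    then show ?thesis
      using is_cokernel_Comp_epic[OF _ f e] by blast
  qed
  then show ?thesis
    unfolding exact_at_def using HomD[OF f] HomD[OF fe] by simp
qed

lemma exact_arrows_Cons:
  "exact_arrows A (f # g # fs) \<longleftrightarrow> f \<in> Arr A \<and> exact_at A f g \<and> exact_arrows A (g # fs)"
proof -
  have "(\<forall>i. Suc i < length (f # g # fs) \<longrightarrow> exact_at A ((f # g # fs) ! i) ((f # g # fs) ! Suc i))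
    \<longleftrightarrow> exact_at A f g \<and>
      (\<forall>i. Suc i < length (g # fs) \<longrightarrow> exact_at A ((g # fs) ! i) ((g # fs) ! Suc i))"
    (is "?L \<longleftrightarrow> ?R")
  proof
    assume L: ?L
    then show ?R
      by fastforce
  next
    assume R: ?R
    show ?L
    proof (intro allI impI)
      fix i
      assume "Suc i < length (f # g # fs)"
      then show "exact_at A ((f # g # fs) ! i) ((f # g # fs) ! Suc i)"
        using R by (cases i) auto
    qed
  qed
  then show ?thesis
    unfolding exact_arrows_def by auto
qed

lemma exact_arrows_single: "exact_arrows A [f] \<longleftrightarrow> f \<in> Arr A"
  by (simp add: exact_arrows_def)

text \<open>The outer zeros make \<open>f\<close> monic and \<open>g\<close> epic. Exactness in the
  middle then makes \<open>f\<close> a kernel of \<open>g\<close>, and an epic is a cokernel of its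
  kernel.\<close>

lemma short_exact_iff_ses: "short_exact A X f Y g Z \<longleftrightarrow> ses A X f Y g Z"
proof -
  have "short_exact A X f Y g Z \<longleftrightarrow>
    f \<in> Hom A X Y \<and> g \<in> Hom A Y Z \<and> monic A f \<and> exact_at A f g \<and> epic A g"
    (is "_ \<longleftrightarrow> ?R")
  proof
    assume "short_exact A X f Y g Z"
    then obtain O1 O2 where "f \<in> Hom A X Y" "g \<in> Hom A Y Z" "zero_object A O1" "zero_object A O2"
      "exact_arrows A [Zero A O1 X, f, g, Zero A Z O2]"
      unfolding short_exact_def by blast
    then show ?R
      using exact_at_zero_left_iff exact_at_zero_right_iff by (auto simp: exact_arrows_Cons)
  next
    assume R: ?R
    obtain O1 where z: "zero_object A O1"
      using zero_object_exists by blast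
    then have O1: "O1 \<in> Obj A"
      by (simp add: zero_object_def)
    have "Zero A O1 X \<in> Hom A O1 X" "Zero A Z O1 \<in> Hom A Z O1"
      using Zero_in_Hom O1 Hom_Obj R by blast+
    then have "exact_arrows A [Zero A O1 X, f, g, Zero A Z O1]"
      using R z exact_at_zero_left_iff exact_at_zero_right_iff
      by (auto simp: exact_arrows_Cons exact_arrows_single dest: HomD)
    then show "short_exact A X f Y g Z"
      unfolding short_exact_def using R z by blast
  qed
  also have "\<dots> \<longleftrightarrow> ses A X f Y g Z"
    using exact_at_monic_iff ses_epicI ses_monic_epic by (metis sesD(1-3))
  finally show ?thesis .
qed

end


section \<open>Constructions with short exact sequences\<close>

text \<open>The universal property is split into existence of the factorisation and joint monicity
  of \<open>p\<close> and \<open>q\<close>, so that each can be used alone.\<close>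

definition pullback ::
  "('o, 'm) precategory \<Rightarrow> 'o \<Rightarrow> 'm \<Rightarrow> 'o \<Rightarrow> 'm \<Rightarrow> 'o \<Rightarrow> 'm \<Rightarrow> 'm \<Rightarrow> 'o \<Rightarrow> bool" where
  "pullback A P p W q Y h g Z \<longleftrightarrow>
     p \<in> Hom A P W \<and> q \<in> Hom A P Y \<and> h \<in> Hom A W Z \<and> g \<in> Hom A Y Z \<and>
     h \<cdot>\<^bsub>A\<^esub> p = g \<cdot>\<^bsub>A\<^esub> q \<and>
     (\<forall>V. \<forall>a\<in>Hom A V W. \<forall>b\<in>Hom A V Y. h \<cdot>\<^bsub>A\<^esub> a = g \<cdot>\<^bsub>A\<^esub> b \<longrightarrow>
        (\<exists>u\<in>Hom A V P. p \<cdot>\<^bsub>A\<^esub> u = a \<and> q \<cdot>\<^bsub>A\<^esub> u = b)) \<and>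
     (\<forall>V. \<forall>u\<in>Hom A V P. \<forall>v\<in>Hom A V P. p \<cdot>\<^bsub>A\<^esub> u = p \<cdot>\<^bsub>A\<^esub> v \<longrightarrow> q \<cdot>\<^bsub>A\<^esub> u = q \<cdot>\<^bsub>A\<^esub> v \<longrightarrow> u = v)"

lemma pullback_sym: "pullback A P p W q Y h g Z \<Longrightarrow> pullback A P q Y p W g h Z"
  unfolding pullback_def by metis

context abelian_category
begin

text \<open>\<open>P\<close> is the kernel of \<open>\<phi> = g x - h y\<close> on the biproduct of
  \<open>Y\<close> and \<open>W\<close>. If \<open>g\<close> or \<open>h\<close> is epic then so is
  \<open>\<phi>\<close>, which is then a cokernel of \<open>k\<close>; this is what carries epics
  over to the opposite side of the square.\<close>

lemma pullback_epic_exists: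
  assumes h: "h \<in> Hom A W Z" and g: "g \<in> Hom A Y Z"
  obtains P p q where "pullback A P p W q Y h g Z"
    "epic A g \<Longrightarrow> epic A p" "epic A h \<Longrightarrow> epic A q"
proof -
  have obj: "W \<in> Obj A" "Y \<in> Obj A" "Z \<in> Obj A"
    using Hom_Obj h g by auto
  obtain S i j x y where "biproduct A Y W S i j x y"
    using direct_sum_exists[OF obj(2,1)] unfolding direct_sum_def by blast
  then have i: "i \<in> Hom A Y S" and j: "j \<in> Hom A W S" and x: "x \<in> Hom A S Y" and y: "y \<in> Hom A S W"
    and xi: "x \<cdot> i = Ident A Y" and yj: "y \<cdot> j = Ident A W"
    and xj: "x \<cdot> j = Zero A W Y" and yi: "y \<cdot> i = Zero A Y W"
    and id: "Add A (i \<cdot> x) (j \<cdot> y) = Ident A S"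
    by (auto simp: biproduct_def)
  have S: "S \<in> Obj A"
    using Hom_Obj[OF x] by simp
  have gx: "g \<cdot> x \<in> Hom A S Z" and hy: "h \<cdot> y \<in> Hom A S Z"
    using Comp_in_Hom x y g h by blast+
  obtain \<phi> where \<phi>: "\<phi> \<in> Hom A S Z" "Add A \<phi> (h \<cdot> y) = g \<cdot> x"
    using difference[OF gx hy] .
  have sum: "Add A (\<phi> \<cdot> s) (h \<cdot> (y \<cdot> s)) = g \<cdot> (x \<cdot> s)" if s: "s \<in> Hom A V S" for s V
    using Add_Comp[OF s \<phi>(1) hy] \<phi>(2) Comp_assoc[OF s x g] Comp_assoc[OF s y h] by simp
  have \<phi>i: "\<phi> \<cdot> i = g"
    using sum[OF i] Comp_in_Hom[OF i \<phi>(1)]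
    by (simp add: xi yi Comp_Zero[OF h obj(2)] Comp_Ident[OF g] Add_Zero)
  have \<phi>j: "Add A (\<phi> \<cdot> j) h = Zero A W Z"
    using sum[OF j] by (simp add: xj yj Comp_Zero[OF g obj(1)] Comp_Ident[OF h])
  obtain P k where k: "k \<in> Hom A P S" "is_kernel A k \<phi>"
    using kernel_Hom_exists[OF \<phi>(1)] .
  define p where "p = y \<cdot> k"
  define q where "q = x \<cdot> k"
  have p: "p \<in> Hom A P W" and q: "q \<in> Hom A P Y"
    unfolding p_def q_def using Comp_in_Hom k x y by blast+
  have eq_iff: "\<phi> \<cdot> s = Zero A V Z \<longleftrightarrow> h \<cdot> (y \<cdot> s) = g \<cdot> (x \<cdot> s)" if s: "s \<in> Hom A V S" for s V
  proof -
    have a: "\<phi> \<cdot> s \<in> Hom A V Z" "h \<cdot> (y \<cdot> s) \<in> Hom A V Z"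
      using Comp_in_Hom s \<phi>(1) y h by blast+
    show ?thesis
      using sum[OF s] Zero_Add[OF a(2)] Add_eq_right[OF a] by metis
  qed
  have pb: "pullback A P p W q Y h g Z"
    unfolding pullback_def
  proof (intro conjI allI ballI impI)
    show "h \<cdot> p = g \<cdot> q"
      using eq_iff[OF k(1)] is_kernel_zero[OF k(2,1) \<phi>(1)] by (simp add: p_def q_def)
  next
    fix V a b
    assume a: "a \<in> Hom A V W" and b: "b \<in> Hom A V Y" and ab: "h \<cdot> a = g \<cdot> b"
    have V: "V \<in> Obj A"
      using Hom_Obj[OF a] by simp
    have ib: "i \<cdot> b \<in> Hom A V S" and ja: "j \<cdot> a \<in> Hom A V S"
      using Comp_in_Hom a b i j by blast+
    \<comment> \<open>The arrow into the biproduct with components \<open>b\<close> and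
      \<open>a\<close>.\<close>
    let ?s = "Add A (i \<cdot> b) (j \<cdot> a)"
    have s: "?s \<in> Hom A V S"
      using Add_in_Hom[OF ib ja] .
    have xs: "x \<cdot> ?s = b"
      using Comp_Add[OF ib ja x]
      by (simp add: Comp_assoc[OF b i x, symmetric] Comp_assoc[OF a j x, symmetric]
        xi xj Ident_Comp[OF b] Zero_Comp[OF a obj(2)] Add_Zero[OF b])
    have ys: "y \<cdot> ?s = a"
      using Comp_Add[OF ib ja y]
      by (simp add: Comp_assoc[OF b i y, symmetric] Comp_assoc[OF a j y, symmetric]
        yi yj Ident_Comp[OF a] Zero_Comp[OF b obj(1)] Zero_Add[OF a])
    obtain u where u: "u \<in> Hom A V P" "k \<cdot> u = ?s"
      using is_kernel_factor[OF k(2,1) \<phi>(1) s] eq_iff[OF s] xs ys ab by auto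
    then show "\<exists>u\<in>Hom A V P. p \<cdot> u = a \<and> q \<cdot> u = b"
      using Comp_assoc[OF u(1) k(1) x] Comp_assoc[OF u(1) k(1) y] xs ys by (auto simp: p_def q_def)
  next
    fix V u v
    assume u: "u \<in> Hom A V P" and v: "v \<in> Hom A V P" and eq: "p \<cdot> u = p \<cdot> v" "q \<cdot> u = q \<cdot> v"
    \<comment> \<open>The composite \<open>k \<cdot> w\<close> is recovered from its two components,
      so \<open>p\<close> and \<open>q\<close> together determine it.\<close>
    have expand: "k \<cdot> w = Add A (i \<cdot> (q \<cdot> w)) (j \<cdot> (p \<cdot> w))" if w: "w \<in> Hom A V P" for w
    proof -
      have kw: "k \<cdot> w \<in> Hom A V S"
        using Comp_in_Hom w k by blast
      have "k \<cdot> w = Add A (i \<cdot> x) (j \<cdot> y) \<cdot> (k \<cdot> w)"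
        using id Ident_Comp[OF kw] by simp
      also have "\<dots> = Add A (i \<cdot> x \<cdot> (k \<cdot> w)) (j \<cdot> y \<cdot> (k \<cdot> w))"
        using Add_Comp[OF kw Comp_in_Hom[OF x i] Comp_in_Hom[OF y j]] .
      finally show ?thesis
        using Comp_assoc[OF kw x i] Comp_assoc[OF kw y j] Comp_assoc[OF w k(1) x]
          Comp_assoc[OF w k(1) y] by (simp add: p_def q_def)
    qed
    have "k \<cdot> u = k \<cdot> v"
      using expand[OF u] expand[OF v] eq by simp
    then show "u = v"
      using monic_cancel[OF kernel_monic[OF k(2)] k(1) u v] by blast
  qed (use p q h g in auto)
  \<comment> \<open>On the summands \<open>Y\<close> and \<open>W\<close> the arrow
    \<open>\<phi>\<close> restricts to \<open>g\<close> and to \<open>- h\<close>, so one of them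
    being epic suffices.\<close>
  have coker: "is_cokernel A \<phi> k" if "epic A g \<or> epic A h"
  proof -
    have "epic A \<phi>"
    proof (rule epicI[OF \<phi>(1)])
      fix V t
      assume t: "t \<in> Hom A Z V" and z: "t \<cdot> \<phi> = Zero A S V"
      have V: "V \<in> Obj A"
        using Hom_Obj[OF t] by simp
      have tg: "t \<cdot> g = Zero A Y V"
        using Comp_assoc[OF i \<phi>(1) t] z \<phi>i Zero_Comp[OF i V] by simp
      have \<phi>j0: "t \<cdot> (\<phi> \<cdot> j) = Zero A W V"
        using Comp_assoc[OF j \<phi>(1) t] z Zero_Comp[OF j V] by simp
      have "t \<cdot> h = Zero A W V"
        using Comp_Add[OF Comp_in_Hom[OF j \<phi>(1)] h t]
        by (simp add: \<phi>j \<phi>j0 Comp_Zero[OF t obj(1)] Zero_Add[OF Comp_in_Hom[OF h t]])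
      then show "t = Zero A Z V"
        using that tg epic_zero[OF _ g t] epic_zero[OF _ h t] by blast
    qed
    then show ?thesis
      using epic_is_cokernel_of_kernel[OF _ \<phi>(1) k] by blast
  qed
  have ep: "epic A p" if e: "epic A g"
  proof (rule epicI[OF p])
    fix V t
    assume t: "t \<in> Hom A W V" and z: "t \<cdot> p = Zero A P V"
    have V: "V \<in> Obj A"
      using Hom_Obj[OF t] by simp
    have ty: "t \<cdot> y \<in> Hom A S V"
      using Comp_in_Hom t y by blast
    have "t \<cdot> y \<cdot> k = Zero A P V"
      using z Comp_assoc[OF k(1) y t] by (simp add: p_def)
    \<comment> \<open>\<open>t \<cdot> y\<close> kills \<open>k\<close> and hence descends along
      \<open>\<phi>\<close>. On the summand \<open>Y\<close> it is zero, so \<open>w\<close> kills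
      the epic \<open>g\<close> and vanishes.\<close>
    then obtain w where w: "w \<in> Hom A Z V" "w \<cdot> \<phi> = t \<cdot> y"
      using is_cokernel_factor[OF coker k(1) \<phi>(1) ty] e by blast
    have "w \<cdot> g = t \<cdot> (y \<cdot> i)"
      using Comp_assoc[OF i \<phi>(1) w(1)] w(2) \<phi>i Comp_assoc[OF i y t] by simp
    then have "w \<cdot> g = Zero A Y V"
      using yi Comp_Zero[OF t obj(2)] by simp
    then have w0: "w = Zero A Z V"
      using epic_zero[OF e g w(1)] by blast
    have "t = t \<cdot> y \<cdot> j"
      using Comp_assoc[OF j y t] yj Comp_Ident[OF t] by simp
    also have "\<dots> = Zero A W V"
      using w(2) w0 Zero_Comp[OF \<phi>(1) V] Zero_Comp[OF j V] by simp
    finally show "t = Zero A W V" .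
  qed
  have eq: "epic A q" if e: "epic A h"
  proof (rule epicI[OF q])
    fix V t
    assume t: "t \<in> Hom A Y V" and z: "t \<cdot> q = Zero A P V"
    have V: "V \<in> Obj A"
      using Hom_Obj[OF t] by simp
    have tx: "t \<cdot> x \<in> Hom A S V"
      using Comp_in_Hom t x by blast
    have "t \<cdot> x \<cdot> k = Zero A P V"
      using z Comp_assoc[OF k(1) x t] by (simp add: q_def)
    then obtain w where w: "w \<in> Hom A Z V" "w \<cdot> \<phi> = t \<cdot> x"
      using is_cokernel_factor[OF coker k(1) \<phi>(1) tx] e by blast
    have "w \<cdot> (\<phi> \<cdot> j) = t \<cdot> (x \<cdot> j)"
      using Comp_assoc[OF j \<phi>(1) w(1)] w(2) Comp_assoc[OF j x t] by simp
    then have "w \<cdot> (\<phi> \<cdot> j) = Zero A W V"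
      using xj Comp_Zero[OF t obj(1)] by simp
    then have "w \<cdot> h = Zero A W V"
      using Comp_Add[OF Comp_in_Hom[OF j \<phi>(1)] h w(1)]
      by (simp add: \<phi>j Comp_Zero[OF w(1) obj(1)] Zero_Add[OF Comp_in_Hom[OF h w(1)]])
    then have w0: "w = Zero A Z V"
      using epic_zero[OF e h w(1)] by blast
    have "t = t \<cdot> x \<cdot> i"
      using Comp_assoc[OF i x t] xi Comp_Ident[OF t] by simp
    also have "\<dots> = Zero A Y V"
      using w(2) w0 Zero_Comp[OF \<phi>(1) V] Zero_Comp[OF i V] by simp
    finally show "t = Zero A Y V" .
  qed
  show ?thesis
    using that[OF pb ep eq] .
qed

text \<open>The kernel is unchanged by pullback: \<open>k'\<close> is the arrow into
  \<open>P\<close> with components \<open>0\<close> and \<open>k\<close>.\<close>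

lemma pullback_ses:
  assumes pb: "pullback A P p W q Y h g Z" and e: "epic A p" and k: "k \<in> Hom A K Y" "is_kernel A k g"
  obtains k' where "ses A K k' P p W" "q \<cdot> k' = k"
proof -
  have p: "p \<in> Hom A P W" and q: "q \<in> Hom A P Y" and h: "h \<in> Hom A W Z" and g: "g \<in> Hom A Y Z"
    and hp: "h \<cdot> p = g \<cdot> q"
    using pb by (auto simp: pullback_def)
  have K: "K \<in> Obj A" and W: "W \<in> Obj A" and Z: "Z \<in> Obj A"
    using Hom_Obj k p g by auto
  have z: "Zero A K W \<in> Hom A K W"
    using Zero_in_Hom K W .
  have "h \<cdot> Zero A K W = g \<cdot> k"
    using Comp_Zero[OF h K] is_kernel_zero[OF k(2,1) g] by simp
  then obtain k' where k': "k' \<in> Hom A K P" "p \<cdot> k' = Zero A K W" "q \<cdot> k' = k"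
    using pb z k(1) unfolding pullback_def by meson
  have "is_kernel A k' p"
  proof (rule is_kernelI[OF k'(1) p k'(2)])
    show "monic A k'"
    proof (rule monicI[OF k'(1)])
      fix V t
      assume t: "t \<in> Hom A V K" "k' \<cdot> t = Zero A V P"
      have "k \<cdot> t = Zero A V Y"
        using Comp_assoc[OF t(1) k'(1) q] k'(3) t(2) Comp_Zero[OF q] Hom_Obj[OF t(1)] by simp
      then show "t = Zero A V K"
        using monic_zero[OF kernel_monic[OF k(2)] k(1) t(1)] by blast
    qed
  next
    fix V t
    assume t: "t \<in> Hom A V P" "p \<cdot> t = Zero A V W"
    have V: "V \<in> Obj A"
      using Hom_Obj[OF t(1)] by simp
    have "g \<cdot> (q \<cdot> t) = h \<cdot> (p \<cdot> t)"
      using Comp_assoc[OF t(1) q g] Comp_assoc[OF t(1) p h] hp by simp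
    then have "g \<cdot> (q \<cdot> t) = Zero A V Z"
      using t(2) Comp_Zero[OF h V] by simp
    then obtain u where u: "u \<in> Hom A V K" "k \<cdot> u = q \<cdot> t"
      using is_kernel_factor[OF k(2,1) g Comp_in_Hom[OF t(1) q]] by blast
    have ku: "k' \<cdot> u \<in> Hom A V P"
      using Comp_in_Hom u k' by blast
    have "p \<cdot> (k' \<cdot> u) = p \<cdot> t" "q \<cdot> (k' \<cdot> u) = q \<cdot> t"
      using Comp_assoc[OF u(1) k'(1) p] Comp_assoc[OF u(1) k'(1) q] k'(2,3) u(2) t(2)
        Zero_Comp[OF u(1) W] by simp_all
    then have "k' \<cdot> u = t"
      using pb ku t(1) unfolding pullback_def by blast
    then show "\<exists>u\<in>Hom A V K. k' \<cdot> u = t"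
      using u(1) by blast
  qed
  then show ?thesis
    using that[OF ses_epicI[OF e k'(1) p] k'(3)] by blast
qed

section \<open>Combining and splitting short exact sequences\<close>

lemma ses_pullback:
  assumes "ses A M a T b N" and "ses A K c N' d N"
  obtains P k l p q where "ses A M k P p N'" "ses A K l P q T"
proof -
  obtain P p q where pb: "pullback A P p N' q T d b N" and e: "epic A p" "epic A q"
    using pullback_epic_exists[OF sesD(2)[OF assms(2)] sesD(2)[OF assms(1)]]
      ses_monic_epic[OF assms(1)] ses_monic_epic[OF assms(2)] by metis
  obtain k where "ses A M k P p N'"
    using pullback_ses[OF pb e(1) sesD(1,3)[OF assms(1)]] by blast
  moreover obtain l where "ses A K l P q T"
    using pullback_ses[OF pullback_sym[OF pb] e(2) sesD(1,3)[OF assms(2)]] by blast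
  ultimately show ?thesis
    using that by blast
qed

text \<open>\<open>U\<close> is the preimage of the subobject \<open>W\<close> under
  \<open>g\<close>, constructed as a pullback, and it is also the kernel of the composite
  epic.\<close>

lemma ses_Comp_epic:
  assumes fg: "ses A X f Y g Z" and wr: "ses A W w Z r V"
  obtains U u f' p where "ses A X f' U p W" "ses A U u Y (r \<cdot> g) V"
proof -
  note f = sesD(1)[OF fg] and g = sesD(2)[OF fg] and w = sesD(1)[OF wr] and r = sesD(2)[OF wr]
  have rg: "r \<cdot> g \<in> Hom A Y V" "epic A (r \<cdot> g)"
    using Comp_in_Hom[OF g r] epic_Comp[OF _ r _ g] ses_monic_epic[OF fg] ses_monic_epic[OF wr]
    by blast+
  obtain U p u where pb: "pullback A U p W u Y w g Z" and e: "epic A p"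
    using pullback_epic_exists[OF w g] ses_monic_epic[OF fg] by metis
  have p: "p \<in> Hom A U W" and u: "u \<in> Hom A U Y" and wp: "w \<cdot> p = g \<cdot> u"
    using pb by (auto simp: pullback_def)
  have V: "V \<in> Obj A"
    using Hom_Obj[OF r] by simp
  have "is_kernel A u (r \<cdot> g)"
  proof (rule is_kernelI[OF u rg(1)])
    show "r \<cdot> g \<cdot> u = Zero A U V"
      using Comp_assoc[OF u g r] Comp_assoc[OF p w r] wp ses_zero[OF wr] Zero_Comp[OF p V] by simp
    show "monic A u"
    proof (rule monicI[OF u])
      fix S t
      assume t: "t \<in> Hom A S U" "u \<cdot> t = Zero A S Y"
      have S: "S \<in> Obj A"
        using Hom_Obj[OF t(1)] by simp
      have "w \<cdot> (p \<cdot> t) = g \<cdot> (u \<cdot> t)"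
        using Comp_assoc[OF t(1) p w] Comp_assoc[OF t(1) u g] wp by simp
      then have "w \<cdot> (p \<cdot> t) = Zero A S Z"
        using t(2) Comp_Zero[OF g S] by simp
      then have pt: "p \<cdot> t = Zero A S W"
        using monic_zero[OF _ w Comp_in_Hom[OF t(1) p]] ses_monic_epic[OF wr] by blast
      have z: "Zero A S U \<in> Hom A S U"
        using Zero_in_Hom[OF S] Hom_Obj[OF p] by blast
      have "p \<cdot> t = p \<cdot> Zero A S U" "u \<cdot> t = u \<cdot> Zero A S U"
        using pt t(2) Comp_Zero[OF p S] Comp_Zero[OF u S] by simp_all
      then show "t = Zero A S U"
        using pb t(1) z unfolding pullback_def by blast
    qed
  next
    fix S t
    assume t: "t \<in> Hom A S Y" "r \<cdot> g \<cdot> t = Zero A S V"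
    then have "r \<cdot> (g \<cdot> t) = Zero A S V"
      using Comp_assoc[OF t(1) g r] by simp
    then obtain s where s: "s \<in> Hom A S W" "w \<cdot> s = g \<cdot> t"
      using is_kernel_factor[OF sesD(3)[OF wr] w r Comp_in_Hom[OF t(1) g]] by blast
    then show "\<exists>v\<in>Hom A S U. u \<cdot> v = t"
      using pb t(1) unfolding pullback_def by blast
  qed
  then have "ses A U u Y (r \<cdot> g) V"
    using ses_epicI[OF rg(2) u rg(1)] by blast
  moreover obtain f' where "ses A X f' U p W"
    using pullback_ses[OF pb e f sesD(3)[OF fg]] by blast
  ultimately show ?thesis
    using that by blast
qed

text \<open>The dual is the third isomorphism theorem: \<open>Q = T / X\<close> contains
  \<open>Z = Y / X\<close> with quotient \<open>N = T / Y\<close>.\<close>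

lemma ses_Comp_monic:
  assumes "ses A X f Y g Z" and "ses A Y i T j N"
  obtains Q q a b where "ses A X (i \<cdot> f) T q Q" "ses A Z a Q b N"
  using abelian_category.ses_Comp_epic[OF opp_abelian_category, of N j T i Y Z g f X] assms
  by (simp, metis)

text \<open>The arrow \<open>t = 1 - k r\<close> kills \<open>k\<close>, so it descends along
  \<open>q\<close> to an arrow \<open>s\<close>. This \<open>s\<close> is a section of
  \<open>q\<close> and completes the biproduct.\<close>

lemma ses_split:
  assumes "ses A K k Y q X" and r: "r \<in> Hom A Y K" "r \<cdot> k = Ident A K"
  shows "direct_sum A K X Y"
proof -
  note k = sesD(1)[OF assms(1)] and q = sesD(2)[OF assms(1)]
  have obj: "K \<in> Obj A" "Y \<in> Obj A" "X \<in> Obj A"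
    using Hom_Obj k q by auto
  have id: "Ident A Y \<in> Hom A Y Y" and kr: "k \<cdot> r \<in> Hom A Y Y"
    using Ident_in_Hom[OF obj(2)] Comp_in_Hom[OF r(1) k] .
  obtain t where t: "t \<in> Hom A Y Y" "Add A t (k \<cdot> r) = Ident A Y"
    using difference[OF id kr] .
  have krk: "k \<cdot> r \<cdot> k = k"
    using Comp_assoc[OF k r(1) k] r(2) Comp_Ident[OF k] by simp
  have "Add A (t \<cdot> k) k = k"
    using Add_Comp[OF k t(1) kr] t(2) krk Ident_Comp[OF k] by simp
  then have "t \<cdot> k = Zero A K Y"
    using Add_eq_right[OF Comp_in_Hom[OF k t(1)] k] by blast
  then obtain s where s: "s \<in> Hom A X Y" "s \<cdot> q = t"
    using is_cokernel_factor[OF sesD(4)[OF assms(1)] k q t(1)] by blast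
  have e: "epic A q"
    using ses_monic_epic[OF assms(1)] by blast
  have qk: "q \<cdot> k = Zero A K X"
    using ses_zero[OF assms(1)] .
  have qt: "q \<cdot> t = q"
    using Comp_Add[OF t(1) kr q] t(2) Comp_Ident[OF q] Comp_assoc[OF r(1) k q] qk
      Zero_Comp[OF r(1) obj(3)] Add_Zero[OF Comp_in_Hom[OF t(1) q]] by simp
  have qs: "q \<cdot> s = Ident A X"
    using epic_cancel[OF e q Comp_in_Hom[OF s(1) q] Ident_in_Hom[OF obj(3)]]
      Comp_assoc[OF q s(1) q] s(2) qt Ident_Comp[OF q] by simp
  have "Add A (r \<cdot> t) r = r"
    using Comp_Add[OF t(1) kr r(1)] t(2) Comp_Ident[OF r(1)] Comp_assoc[OF r(1) k r(1)] r(2)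
      Ident_Comp[OF r(1)] by simp
  then have "r \<cdot> t = Zero A Y K"
    using Add_eq_right[OF Comp_in_Hom[OF t(1) r(1)] r(1)] by blast
  then have rs: "r \<cdot> s = Zero A X K"
    using epic_zero[OF e q Comp_in_Hom[OF s(1) r(1)]] Comp_assoc[OF q s(1) r(1)] s(2) by simp
  have "Add A (k \<cdot> r) (s \<cdot> q) = Ident A Y"
    using t(2) s(2) Add_comm[OF t(1) kr] by simp
  then have "biproduct A K X Y k s r q"
    unfolding biproduct_def using k s(1) r q qs rs qk by simp
  then show ?thesis
    unfolding direct_sum_def using obj by blast
qed

lemma injective_Comp:
  assumes "injective_object A J" "monic A f" "f \<in> Hom A X Y" "g \<in> Hom A X J"
  obtains h where "h \<in> Hom A Y J" "h \<cdot> f = g"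
  using assms HomD[OF assms(3)] unfolding injective_object_def by metis


section \<open>Finite coresolutions\<close>

text \<open>The kernel arrow of the monic \<open>f\<close> is zero. As \<open>f\<close> is a
  cokernel of it, the identity of \<open>X\<close> factors through \<open>f\<close>.\<close>

lemma monic_epic_isomorphic:
  assumes f: "f \<in> Hom A X Y" and "monic A f" "epic A f"
  shows "isomorphic A Y X"
proof -
  have obj: "X \<in> Obj A" "Y \<in> Obj A"
    using Hom_Obj f by auto
  obtain K k where k: "ses A K k X f Y"
    using epic_ses[OF assms(3) f] by blast
  note kh = sesD(1)[OF k]
  have "k = Zero A K X"
    using monic_zero[OF assms(2) f kh ses_zero[OF k]] .
  then have "Ident A X \<cdot> k = Zero A K X"
    using Ident_Comp[OF kh] by simp
  then obtain v where v: "v \<in> Hom A Y X" "v \<cdot> f = Ident A X"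
    using is_cokernel_factor[OF sesD(4)[OF k] kh f Ident_in_Hom[OF obj(1)]] by blast
  have "f \<cdot> v \<cdot> f = Ident A Y \<cdot> f"
    using Comp_assoc[OF f v(1) f] v(2) Comp_Ident[OF f] Ident_Comp[OF f] by simp
  then have "f \<cdot> v = Ident A Y"
    using epic_cancel[OF assms(3) f Comp_in_Hom[OF v(1) f] Ident_in_Hom[OF obj(2)]] by blast
  then show ?thesis
    unfolding isomorphic_def using obj v f by blast
qed

text \<open>Length zero means that \<open>M\<close> is isomorphic to an object of the subcategory,
  which is closed under isomorphisms.\<close>

lemma has_coresolution_0:
  assumes "subcategory A \<X>"
  shows "has_coresolution A \<X> M 0 \<longleftrightarrow> M \<in> \<X>"
proof
  assume "has_coresolution A \<X> M 0"
  then obtain X e O1 O2 where X: "X (0::nat) \<in> \<X>" and e: "e \<in> Hom A M (X 0)"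
    and O: "zero_object A O1" "zero_object A O2"
    and ex: "exact_arrows A [Zero A O1 M, e, Zero A (X 0) O2]"
    unfolding has_coresolution_def by auto
  then have "monic A e" "epic A e"
    using exact_at_zero_left_iff exact_at_zero_right_iff by (auto simp: exact_arrows_Cons)
  then show "M \<in> \<X>"
    using monic_epic_isomorphic[OF e] assms X unfolding subcategory_def by blast
next
  assume M: "M \<in> \<X>"
  then have MO: "M \<in> Obj A"
    using assms by (auto simp: subcategory_def)
  note i = Ident_in_Hom[OF MO]
  obtain Z where Z: "zero_object A Z"
    using zero_object_exists by blast
  then have ZO: "Z \<in> Obj A"
    by (simp add: zero_object_def)
  have "monic A (Ident A M)" "epic A (Ident A M)"
    using monicI[OF i] epicI[OF i] Ident_Comp Comp_Ident by metis+
  then have "exact_arrows A [Zero A Z M, Ident A M, Zero A M Z]"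
    using exact_at_zero_left_iff[OF Z i] exact_at_zero_right_iff[OF Z i]
      HomD(1)[OF Zero_in_Hom[OF ZO MO]] HomD(1)[OF Zero_in_Hom[OF MO ZO]] HomD(1)[OF i]
    by (simp add: exact_arrows_Cons exact_arrows_single)
  then show "has_coresolution A \<X> M 0"
    unfolding has_coresolution_def using M i Z
    by (intro exI[of _ "\<lambda>_. M"] exI[of _ "Ident A M"] exI[of _ "\<lambda>_. Ident A M"] exI[of _ Z]) simp
qed

lemma exact_arrows_Comp_epic_iff:
  assumes "e \<in> Hom A W X" "epic A e" "f \<in> Hom A X Y"
  shows "exact_arrows A ((f \<cdot> e) # g # gs) \<longleftrightarrow> exact_arrows A (f # g # gs)"
  using exact_at_Comp_epic_iff[OF assms] HomD(1)[OF assms(3)]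
    HomD(1)[OF Comp_in_Hom[OF assms(1,3)]] by (simp add: exact_arrows_Cons)

text \<open>The first term is cut off: \<open>N\<close> is the cokernel of \<open>e\<close>, and
  \<open>d 0\<close> factors through it by a monic \<open>m\<close>, which becomes the new
  augmentation. With the converse below this permits induction on the length.\<close>

lemma has_coresolution_SucD:
  assumes "has_coresolution A \<X> M (Suc n)"
  obtains X f g N where "X \<in> \<X>" "ses A M f X g N" "has_coresolution A \<X> N n"
proof -
  obtain X e d O1 O2 where X: "\<forall>i\<le>Suc n. X i \<in> \<X>" and e: "e \<in> Hom A M (X 0)"
    and d: "\<forall>i<Suc n. d i \<in> Hom A (X i) (X (Suc i))"
    and O: "zero_object A O1" "zero_object A O2"
    and ex: "exact_arrows A ([Zero A O1 M, e] @ map d [0..<Suc n] @ [Zero A (X (Suc n)) O2])"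
    using assms unfolding has_coresolution_def by blast
  define R where "R = map (\<lambda>i. d (Suc i)) [0..<n] @ [Zero A (X (Suc n)) O2]"
  \<comment> \<open>The list ends with the arrow to zero, so it is nonempty and has a head for the
    exactness lemmas to act on.\<close>
  obtain r rs where R: "R = r # rs"
    unfolding R_def by (metis Nil_is_append_conv list.exhaust not_Cons_self2)
  have ex': "exact_at A (Zero A O1 M) e" "exact_at A e (d 0)" "exact_arrows A (d 0 # R)"
    using ex unfolding map_upt_Suc R_def by (auto simp: exact_arrows_Cons)
  have d0: "d 0 \<in> Hom A (X 0) (X 1)"
    using d by simp
  have em: "monic A e"
    using ex'(1) exact_at_zero_left_iff[OF O(1) e] by blast
  have ek: "is_kernel A e (d 0)"
    using ex'(2) exact_at_monic_iff[OF em e d0] by blast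
  obtain N c where c: "c \<in> Hom A (X 0) N" "is_cokernel A c e"
    using cokernel_Hom_exists[OF e] .
  obtain m where m: "m \<in> Hom A N (X 1)" "m \<cdot> c = d 0"
    using is_cokernel_factor[OF c(2) e c(1) d0 is_kernel_zero[OF ek e d0]] .
  have "monic A m"
    using coimage_factor_monic[OF d0 e ek c m] .
  then have "exact_at A (Zero A O1 N) m"
    using exact_at_zero_left_iff[OF O(1) m(1)] by blast
  moreover have "exact_arrows A (m # R)"
    using ex'(3) exact_arrows_Comp_epic_iff[OF c(1) cokernel_epic[OF c(2)] m(1)] m(2) R by simp
  ultimately have "exact_arrows A ([Zero A O1 N, m] @ R)"
    by (simp add: exact_arrows_Cons exact_at_def)
  then have "has_coresolution A \<X> N n"
    unfolding has_coresolution_def R_def using X d m(1) O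
    by (intro exI[of _ "\<lambda>i. X (Suc i)"] exI[of _ m] exI[of _ "\<lambda>i. d (Suc i)"]
        exI[of _ O1] exI[of _ O2]) simp
  then show ?thesis
    using that[OF _ ses_monicI[OF em e c]] X by blast
qed

text \<open>Splicing at \<open>N\<close>: the monic \<open>e\<close> leaves the kernel of
  \<open>g\<close> unchanged, and the epic \<open>g\<close> leaves exactness after \<open>e\<close>
  unchanged. \<open>case_nat\<close> puts the new term in degree zero and shifts the others.\<close>

lemma has_coresolution_SucI:
  assumes "X \<in> \<X>" and MXN: "ses A M f X g N" and "has_coresolution A \<X> N n"
  shows "has_coresolution A \<X> M (Suc n)"
proof -
  note f = sesD(1)[OF MXN] and g = sesD(2)[OF MXN]
  obtain Y e d O1 O2 where Y: "\<forall>i\<le>n. Y i \<in> \<X>" and e: "e \<in> Hom A N (Y 0)"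
    and d: "\<forall>i<n. d i \<in> Hom A (Y i) (Y (Suc i))"
    and O: "zero_object A O1" "zero_object A O2"
    and ex: "exact_arrows A ([Zero A O1 N, e] @ map d [0..<n] @ [Zero A (Y n) O2])"
    using assms(3) unfolding has_coresolution_def by blast
  define R where "R = map d [0..<n] @ [Zero A (Y n) O2]"
  obtain r rs where R: "R = r # rs"
    unfolding R_def by (metis Nil_is_append_conv list.exhaust not_Cons_self2)
  have ex': "exact_at A (Zero A O1 N) e" "exact_arrows A (e # R)"
    using ex by (auto simp: exact_arrows_Cons R_def)
  have em: "monic A e"
    using ex'(1) exact_at_zero_left_iff[OF O(1) e] by blast
  have eg: "e \<cdot> g \<in> Hom A X (Y 0)"
    using Comp_in_Hom[OF g e] .
  have "is_kernel A f (e \<cdot> g)"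
    using is_kernel_Comp_monic[OF f g e em] sesD(3)[OF MXN] by blast
  then have "exact_at A f (e \<cdot> g)"
    using exact_at_monic_iff[OF _ f eg] ses_monic_epic[OF MXN] by blast
  moreover have "exact_arrows A ((e \<cdot> g) # R)"
    using ex'(2) exact_arrows_Comp_epic_iff[OF g _ e] ses_monic_epic[OF MXN] R by simp
  moreover have "exact_at A (Zero A O1 M) f"
    using exact_at_zero_left_iff[OF O(1) f] ses_monic_epic[OF MXN] by blast
  ultimately have "exact_arrows A ([Zero A O1 M, f] @ ((e \<cdot> g) # R))"
    by (simp add: exact_arrows_Cons exact_at_def)
  then have "exact_arrows A ([Zero A O1 M, f] @ map (case_nat (e \<cdot> g) d) [0..<Suc n] @ [Zero A (Y n) O2])"
    unfolding map_upt_Suc R_def by simp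
  moreover have "\<forall>i\<le>Suc n. case_nat X Y i \<in> \<X>"
    using Y assms(1) by (auto split: nat.split)
  moreover have "\<forall>i<Suc n. case_nat (e \<cdot> g) d i \<in> Hom A (case_nat X Y i) (case_nat X Y (Suc i))"
    using d eg by (auto split: nat.split)
  ultimately show ?thesis
    unfolding has_coresolution_def using f O
    by (intro exI[of _ "case_nat X Y"] exI[of _ f] exI[of _ "case_nat (e \<cdot> g) d"]
        exI[of _ O1] exI[of _ O2]) simp
qed

lemma has_coresolution_mono:
  assumes "\<X> \<subseteq> \<Y>" "has_coresolution A \<X> M n"
  shows "has_coresolution A \<Y> M n"
proof -
  obtain X e d O1 O2 where "\<forall>i\<le>n. X i \<in> \<X>"
    and *: "e \<in> Hom A M (X 0)" "\<forall>i<n. d i \<in> Hom A (X i) (X (Suc i))" "zero_object A O1"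
      "zero_object A O2" "exact_arrows A ([Zero A O1 M, e] @ map d [0..<n] @ [Zero A (X n) O2])"
    using assms(2) unfolding has_coresolution_def by blast
  then have "\<forall>i\<le>n. X i \<in> \<Y>"
    using assms(1) by blast
  with * show ?thesis
    unfolding has_coresolution_def
    by (intro exI[of _ X] exI[of _ e] exI[of _ d] exI[of _ O1] exI[of _ O2]) simp
qed

end


section \<open>Vanishing of Ext\<close>

text \<open>
  For \<open>(I, d)\<close> an injective resolution of \<open>K\<close>, this says \<open>Ext\<^sup>n(X, K) = 0\<close> for all \<open>n \<ge> 1\<close>.
\<close>

definition hom_acyclic ::
  "('o, 'm) precategory \<Rightarrow> 'o \<Rightarrow> (nat \<Rightarrow> 'o) \<Rightarrow> (nat \<Rightarrow> 'm) \<Rightarrow> bool" where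
  "hom_acyclic A X I d \<longleftrightarrow>
     (\<forall>n. \<forall>f\<in>Hom A X (I (Suc n)). d (Suc n) \<cdot>\<^bsub>A\<^esub> f = Zero A X (I (Suc (Suc n))) \<longrightarrow>
        (\<exists>g\<in>Hom A X (I n). d n \<cdot>\<^bsub>A\<^esub> g = f))"

lemma hom_acyclicD:
  assumes "hom_acyclic A X I d" "f \<in> Hom A X (I (Suc n))"
    "d (Suc n) \<cdot>\<^bsub>A\<^esub> f = Zero A X (I (Suc (Suc n)))"
  obtains g where "g \<in> Hom A X (I n)" "d n \<cdot>\<^bsub>A\<^esub> g = f"
  using assms unfolding hom_acyclic_def by blast

context abelian_category
begin

section \<open>Injective resolutions and their relation to Ext\<close>

lemma injective_resolution_exists:
  assumes inj: "enough_injectives A" and M: "M \<in> Obj A"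
  obtains I e d where "injective_resolution A M I e d"
proof -
  \<comment> \<open>The next arrow is the cokernel of \<open>f\<close> followed by an embedding into
    an injective, which keeps the kernel.\<close>
  have step: "\<exists>g. g \<in> Hom A (Cod A f) (Cod A g) \<and> injective_object A (Cod A g) \<and> exact_at A f g"
    if "f \<in> Arr A" for f
  proof -
    have f: "f \<in> Hom A (Dom A f) (Cod A f)"
      by (rule HomI[OF that refl refl])
    obtain Q c where c: "c \<in> Hom A (Cod A f) Q" "is_cokernel A c f"
      using cokernel_Hom_exists[OF f] .
    have "Q \<in> Obj A"
      using Hom_Obj[OF c(1)] by simp
    then obtain J m where J: "injective_object A J" and m: "m \<in> Hom A Q J" "monic A m"
      using inj unfolding enough_injectives_def by blast
    obtain K k where k: "k \<in> Hom A K (Cod A f)" "is_kernel A k c"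
      using kernel_Hom_exists[OF c(1)] .
    have mc: "m \<cdot> c \<in> Hom A (Cod A f) J"
      using Comp_in_Hom[OF c(1) m(1)] .
    have "is_kernel A k (m \<cdot> c)"
      using is_kernel_Comp_monic[OF k(1) c(1) m] k(2) by simp
    then have "exact_at A f (m \<cdot> c)"
      unfolding exact_at_def HomD(2)[OF mc] using c(2) k(2) that HomD(1)[OF mc] by blast
    then show ?thesis
      using J mc by (intro exI[of _ "m \<cdot> c"]) (simp add: HomD(3)[OF mc])
  qed
  define next_arr where "next_arr f =
    (SOME g. g \<in> Hom A (Cod A f) (Cod A g) \<and> injective_object A (Cod A g) \<and> exact_at A f g)" for f
  have next_arr: "next_arr f \<in> Hom A (Cod A f) (Cod A (next_arr f))"
    "injective_object A (Cod A (next_arr f))" "exact_at A f (next_arr f)" if "f \<in> Arr A" for f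
    using someI_ex[OF step[OF that], folded next_arr_def] by simp_all
  obtain J e where J: "injective_object A J" and e: "e \<in> Hom A M J" "monic A e"
    using inj M unfolding enough_injectives_def by blast
  \<comment> \<open>The recursion starts with the augmentation \<open>e\<close>, so the differential
    in degree \<open>n\<close> is \<open>D (Suc n)\<close>.\<close>
  define D where "D = rec_nat e (\<lambda>_. next_arr)"
  have D_simps: "D 0 = e" "D (Suc n) = next_arr (D n)" for n
    by (simp_all add: D_def)
  have D: "D n \<in> Arr A" for n
  proof (induction n)
    case 0
    show ?case
      using HomD(1)[OF e(1)] by (simp add: D_simps)
  next
    case (Suc n)
    show ?case
      using HomD(1)[OF next_arr(1)[OF Suc]] by (simp add: D_simps)
  qed
  have inj_D: "injective_object A (Cod A (D n))" for n
    using J HomD(3)[OF e(1)] next_arr(2)[OF D] by (cases n) (simp_all add: D_simps)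
  have D_Suc: "exact_at A (D n) (D (Suc n))" "D (Suc n) \<in> Hom A (Cod A (D n)) (Cod A (D (Suc n)))" for n
    using next_arr(1,3)[OF D] by (simp_all add: D_simps)
  have D_0: "e \<in> Hom A M (Cod A (D 0))" "exact_at A e (D (Suc 0))"
    using e(1) HomD(3)[OF e(1)] D_Suc(1)[of 0] by (simp_all add: D_simps(1))
  obtain Z where Z: "zero_object A Z"
    using zero_object_exists by blast
  moreover have "exact_at A (Zero A Z M) e"
    using exact_at_zero_left_iff[OF Z e(1)] e(2) by blast
  ultimately have "injective_resolution A M (\<lambda>n. Cod A (D n)) e (\<lambda>n. D (Suc n))"
    unfolding injective_resolution_def using inj_D D_Suc D_0 by blast
  then show ?thesis
    by (rule that)
qed

lemma injective_resolutionD: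
  assumes "injective_resolution A M I e d"
  shows "injective_object A (I n)" "e \<in> Hom A M (I 0)" "d n \<in> Hom A (I n) (I (Suc n))"
    "is_kernel A e (d 0)" "d (Suc n) \<cdot> d n = Zero A (I n) (I (Suc (Suc n)))"
proof -
  show e: "e \<in> Hom A M (I 0)" and d: "d n \<in> Hom A (I n) (I (Suc n))" and "injective_object A (I n)"
    for n
    using assms by (auto simp: injective_resolution_def)
  have "monic A e"
    using assms exact_at_zero_left_iff[OF _ e] unfolding injective_resolution_def by blast
  then show "is_kernel A e (d 0)"
    using assms exact_at_monic_iff[OF _ e d] unfolding injective_resolution_def by blast
  show "d (Suc n) \<cdot> d n = Zero A (I n) (I (Suc (Suc n)))"
    using assms exact_at_zero[OF _ d d] unfolding injective_resolution_def by blast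
qed

text \<open>The resolution chosen in the definition of \<open>Ext\<close> serves all objects of
  \<open>\<C>\<close> at once. Each cocycle lies in its own coset of the coboundaries, and a trivial
  quotient has only one coset.\<close>

lemma right_perp_acyclic:
  assumes inj: "enough_injectives A" and M: "M \<in> right_perp A \<C>" and C: "\<C> \<subseteq> Obj A"
  obtains I e d where "injective_resolution A M I e d" "\<And>X. X \<in> \<C> \<Longrightarrow> hom_acyclic A X I d"
proof -
  have MO: "M \<in> Obj A"
    using M by (simp add: right_perp_def)
  obtain I d where Id: "chosen_resolution A M = (I, d)"
    by fastforce
  obtain I' e' d' where "injective_resolution A M I' e' d'"
    using injective_resolution_exists[OF inj MO] .
  \<comment> \<open>Some resolution exists, so the pair picked by \<open>SOME\<close> is one as
    well.\<close>
  then have "case (I', d') of (I, d) \<Rightarrow> \<exists>e. injective_resolution A M I e d"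
    by auto
  then have "case chosen_resolution A M of (I, d) \<Rightarrow> \<exists>e. injective_resolution A M I e d"
    unfolding chosen_resolution_def by (rule someI)
  then obtain e where res: "injective_resolution A M I e d"
    using Id by auto
  note d = injective_resolutionD(3)[OF res]
  have "hom_acyclic A X I d" if X: "X \<in> \<C>" for X
    unfolding hom_acyclic_def
  proof (intro allI ballI impI)
    fix n f
    assume f: "f \<in> Hom A X (I (Suc n))" and z: "d (Suc n) \<cdot> f = Zero A X (I (Suc (Suc n)))"
    let ?B = "hom_coboundaries A X I d (Suc n)"
    let ?G = "hom_group A X (I (Suc n))"
    let ?Z = "?G\<lparr>carrier := hom_cocycles A X I d (Suc n)\<rparr>"
    have "trivial_group (Ext A (Suc n) X M)"
      using M X by (simp add: right_perp_def)
    then have "trivial_group (?Z Mod ?B)"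
      by (simp add: Ext_def Id)
    then have "rcosets\<^bsub>?Z\<^esub> ?B = {?B}"
      by (simp add: trivial_group_def FactGroup_def)
    moreover have "f \<in> carrier ?Z"
      using f z by (simp add: hom_cocycles_def kernel_def hom_group_def)
    ultimately have coset: "?B #>\<^bsub>?Z\<^esub> f = ?B"
      unfolding RCOSETS_def by blast
    have XO: "X \<in> Obj A" and IO: "I n \<in> Obj A"
      using X C Hom_Obj[OF d] by auto
    have "Zero A X (I (Suc n)) \<in> ?B"
      using imageI[OF Zero_in_Hom[OF XO IO], of "\<lambda>f. d n \<cdot> f"] Comp_Zero[OF d XO, of n]
      by (simp add: hom_coboundaries_def)
    then have "Add A (Zero A X (I (Suc n))) f \<in> ?B #>\<^bsub>?Z\<^esub> f"
      by (auto simp: r_coset_def hom_group_def)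
    then have "f \<in> ?B"
      using coset Zero_Add[OF f] by simp
    then show "\<exists>g\<in>Hom A X (I n). d n \<cdot> g = f"
      by (auto simp: hom_coboundaries_def)
  qed
  then show ?thesis
    using that res by blast
qed

text \<open>A chase in place of the long exact sequence: Ext of \<open>M\<close> in degree
  \<open>n + 1\<close> sits between Ext of \<open>X\<close> in the same degree and Ext of
  \<open>N\<close> in degree \<open>n + 2\<close>, both zero.\<close>

lemma hom_acyclic_kernel:
  assumes res: "injective_resolution A L I e d" and MXN: "ses A M i X p N"
    and X: "hom_acyclic A X I d" and N: "hom_acyclic A N I d"
  shows "hom_acyclic A M I d"
  unfolding hom_acyclic_def
proof (intro allI ballI impI)
  fix n f
  assume f: "f \<in> Hom A M (I (Suc n))" and z: "d (Suc n) \<cdot> f = Zero A M (I (Suc (Suc n)))"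
  note i = sesD(1)[OF MXN] and p = sesD(2)[OF MXN] and coker = sesD(4)[OF MXN]
  note d = injective_resolutionD(3)[OF res] and dd = injective_resolutionD(5)[OF res]
  have obj: "X \<in> Obj A" "M \<in> Obj A" "\<And>n. I n \<in> Obj A"
    using Hom_Obj i d by blast+
  obtain f' where f': "f' \<in> Hom A X (I (Suc n))" "f' \<cdot> i = f"
    using injective_Comp[OF injective_resolutionD(1)[OF res] _ i f] ses_monic_epic[OF MXN] by blast
  have "d (Suc n) \<cdot> f' \<cdot> i = Zero A M (I (Suc (Suc n)))"
    using Comp_assoc[OF i f'(1) d] f'(2) z by simp
  \<comment> \<open>\<open>h\<close> represents the image of the class of \<open>f\<close> under the
    connecting map.\<close>
  then obtain h where h: "h \<in> Hom A N (I (Suc (Suc n)))" "h \<cdot> p = d (Suc n) \<cdot> f'"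
    using is_cokernel_factor[OF coker i p Comp_in_Hom[OF f'(1) d]] by blast
  have "d (Suc (Suc n)) \<cdot> h \<cdot> p = Zero A X (I (Suc (Suc (Suc n))))"
    using Comp_assoc[OF p h(1) d] h(2) Comp_assoc[OF f'(1) d d] dd Zero_Comp[OF f'(1) obj(3)] by simp
  then have "d (Suc (Suc n)) \<cdot> h = Zero A N (I (Suc (Suc (Suc n))))"
    using epic_zero[OF _ p Comp_in_Hom[OF h(1) d]] ses_monic_epic[OF MXN] by blast
  then obtain g where g: "g \<in> Hom A N (I (Suc n))" "d (Suc n) \<cdot> g = h"
    using hom_acyclicD[OF N h(1)] by blast
  have gp: "g \<cdot> p \<in> Hom A X (I (Suc n))"
    using Comp_in_Hom[OF p g(1)] .
  \<comment> \<open>Since \<open>h\<close> is a coboundary, the extension \<open>f'\<close> can be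
    corrected by \<open>g \<cdot> p\<close> to a cocycle \<open>s\<close> on \<open>X\<close>
    without changing its restriction to \<open>M\<close>.\<close>
  obtain s where s: "s \<in> Hom A X (I (Suc n))" "Add A s (g \<cdot> p) = f'"
    using difference[OF f'(1) gp] .
  have "Add A (d (Suc n) \<cdot> s) (h \<cdot> p) = h \<cdot> p"
    using Comp_Add[OF s(1) gp d] s(2) h(2) Comp_assoc[OF p g(1) d] g(2) by simp
  then have "d (Suc n) \<cdot> s = Zero A X (I (Suc (Suc n)))"
    using Add_eq_right[OF Comp_in_Hom[OF s(1) d] Comp_in_Hom[OF p h(1)]] by blast
  then obtain u where u: "u \<in> Hom A X (I n)" "d n \<cdot> u = s"
    using hom_acyclicD[OF X s(1)] by blast
  have "g \<cdot> p \<cdot> i = Zero A M (I (Suc n))"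
    using Comp_assoc[OF i p g(1)] ses_zero[OF MXN] Comp_Zero[OF g(1) obj(2)] by simp
  then have "f = s \<cdot> i"
    using Add_Comp[OF i s(1) gp] s(2) f'(2) Add_Zero[OF Comp_in_Hom[OF i s(1)]] by simp
  then show "\<exists>g\<in>Hom A M (I n). d n \<cdot> g = f"
    using Comp_assoc[OF i u(1) d] u(2) Comp_in_Hom[OF i u(1)] by auto
qed

text \<open>The obstruction to extending \<open>r\<close> along \<open>i\<close> lies in the first
  Ext group of \<open>N\<close> and \<open>K\<close>. The chase is the preceding one, one degree
  lower.\<close>

lemma hom_acyclic_extend:
  assumes res: "injective_resolution A K I e d" and MXN: "ses A M i X p N"
    and N: "hom_acyclic A N I d" and r: "r \<in> Hom A M K"
  obtains r' where "r' \<in> Hom A X K" "r' \<cdot> i = r"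
proof -
  note i = sesD(1)[OF MXN] and p = sesD(2)[OF MXN] and coker = sesD(4)[OF MXN]
  note d = injective_resolutionD(3)[OF res] and dd = injective_resolutionD(5)[OF res]
    and e = injective_resolutionD(2)[OF res] and ker = injective_resolutionD(4)[OF res]
  have obj: "X \<in> Obj A" "M \<in> Obj A" "\<And>n. I n \<in> Obj A"
    using Hom_Obj i d by blast+
  have er: "e \<cdot> r \<in> Hom A M (I 0)"
    using Comp_in_Hom[OF r e] .
  obtain f where f: "f \<in> Hom A X (I 0)" "f \<cdot> i = e \<cdot> r"
    using injective_Comp[OF injective_resolutionD(1)[OF res] _ i er] ses_monic_epic[OF MXN] by blast
  have "d 0 \<cdot> f \<cdot> i = Zero A M (I (Suc 0))"
    using Comp_assoc[OF i f(1) d] f(2) Comp_assoc[OF r e d] is_kernel_zero[OF ker e d]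
      Zero_Comp[OF r obj(3)] by simp
  then obtain h where h: "h \<in> Hom A N (I (Suc 0))" "h \<cdot> p = d 0 \<cdot> f"
    using is_cokernel_factor[OF coker i p Comp_in_Hom[OF f(1) d]] by blast
  have "d (Suc 0) \<cdot> h \<cdot> p = Zero A X (I (Suc (Suc 0)))"
    using Comp_assoc[OF p h(1) d] h(2) Comp_assoc[OF f(1) d d] dd Zero_Comp[OF f(1) obj(3)] by simp
  then have "d (Suc 0) \<cdot> h = Zero A N (I (Suc (Suc 0)))"
    using epic_zero[OF _ p Comp_in_Hom[OF h(1) d]] ses_monic_epic[OF MXN] by blast
  then obtain g where g: "g \<in> Hom A N (I 0)" "d 0 \<cdot> g = h"
    using hom_acyclicD[OF N h(1)] by blast
  have gp: "g \<cdot> p \<in> Hom A X (I 0)"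
    using Comp_in_Hom[OF p g(1)] .
  obtain s where s: "s \<in> Hom A X (I 0)" "Add A s (g \<cdot> p) = f"
    using difference[OF f(1) gp] .
  have "Add A (d 0 \<cdot> s) (h \<cdot> p) = h \<cdot> p"
    using Comp_Add[OF s(1) gp d] s(2) h(2) Comp_assoc[OF p g(1) d] g(2) by simp
  then have "d 0 \<cdot> s = Zero A X (I (Suc 0))"
    using Add_eq_right[OF Comp_in_Hom[OF s(1) d] Comp_in_Hom[OF p h(1)]] by blast
  \<comment> \<open>In degree zero a cocycle is an arrow into the kernel of \<open>d 0\<close>, that
    is, into \<open>K\<close>.\<close>
  then obtain r' where r': "r' \<in> Hom A X K" "e \<cdot> r' = s"
    using is_kernel_factor[OF ker e d s(1)] by blast
  have "g \<cdot> p \<cdot> i = Zero A M (I 0)"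
    using Comp_assoc[OF i p g(1)] ses_zero[OF MXN] Comp_Zero[OF g(1) obj(2)] by simp
  then have "e \<cdot> r = s \<cdot> i"
    using Add_Comp[OF i s(1) gp] s(2) f(2) Add_Zero[OF Comp_in_Hom[OF i s(1)]] by simp
  then have "e \<cdot> (r' \<cdot> i) = e \<cdot> r"
    using Comp_assoc[OF i r'(1) e] r'(2) by simp
  then have "r' \<cdot> i = r"
    using monic_cancel[OF kernel_monic[OF ker] e Comp_in_Hom[OF i r'(1)] r] by blast
  then show ?thesis
    using that r'(1) by blast
qed

text \<open>Dimension shifting: vanishing passes from the last term of the coresolution back to
  \<open>M\<close>, one kernel at a time.\<close>

lemma has_coresolution_acyclic:
  assumes res: "injective_resolution A K I e d" and C: "subcategory A \<C>"
    and "\<And>X. X \<in> \<C> \<Longrightarrow> hom_acyclic A X I d" "has_coresolution A \<C> M n"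
  shows "hom_acyclic A M I d"
  using assms(4)
proof (induction n arbitrary: M)
  case 0
  then show ?case
    using assms(3) has_coresolution_0[OF C] by blast
next
  case (Suc n)
  then obtain X f g N where "X \<in> \<C>" "ses A M f X g N" "has_coresolution A \<C> N n"
    using has_coresolution_SucD by blast
  then show ?case
    using hom_acyclic_kernel[OF res] Suc.IH assms(3) by blast
qed


section \<open>Comparison of the two dimensions\<close>

lemma coresolvingD:
  assumes "coresolving A \<T>"
  shows "subcategory A \<T>"
    and "\<lbrakk>ses A X f Y g Z; X \<in> \<T>; Z \<in> \<T>\<rbrakk> \<Longrightarrow> Y \<in> \<T>"
    and "\<lbrakk>ses A X f Y g Z; X \<in> \<T>; Y \<in> \<T>\<rbrakk> \<Longrightarrow> Z \<in> \<T>"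
proof -
  show "subcategory A \<T>" "\<lbrakk>ses A X f Y g Z; X \<in> \<T>; Z \<in> \<T>\<rbrakk> \<Longrightarrow> Y \<in> \<T>"
    using assms short_exact_iff_ses unfolding coresolving_def by blast+
  assume s: "ses A X f Y g Z" and "X \<in> \<T>" "Y \<in> \<T>"
  then show "Z \<in> \<T>"
    using assms ses_monic_epic[OF s] sesD(4)[OF s] HomD[OF sesD(1)[OF s]] HomD[OF sesD(2)[OF s]]
    unfolding coresolving_def by metis
qed

text \<open>By induction on the length, with the generator itself as base case. The step enlarges
  \<open>T0\<close> to an extension \<open>P\<close> that maps onto the approximation
  \<open>N'\<close>, covers \<open>P\<close> by \<open>X\<close> in \<open>\<C>\<close>, and takes
  the preimage of \<open>M\<close> in \<open>X\<close>.\<close>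

lemma coresolution_approximation:
  assumes T: "coresolving A \<T>" and C: "subcategory A \<C>"
    and gen: "\<And>T. T \<in> \<T> \<Longrightarrow> \<exists>T'\<in>\<T>. \<exists>X\<in>\<C>. \<exists>f g. ses A T' f X g T"
    and "has_coresolution A \<T> M n"
  obtains K k M' q where "K \<in> \<T>" "ses A K k M' q M" "has_coresolution A \<C> M' n"
proof -
  have "\<exists>K\<in>\<T>. \<exists>k M' q. ses A K k M' q M \<and> has_coresolution A \<C> M' n"
    using assms(4)
  proof (induction n arbitrary: M)
    case 0
    then show ?case
      using gen has_coresolution_0[OF coresolvingD(1)[OF T]] has_coresolution_0[OF C] by blast
  next
    case (Suc n)
    then obtain T0 f g N where T0: "T0 \<in> \<T>" "ses A M f T0 g N" "has_coresolution A \<T> N n"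
      using has_coresolution_SucD by blast
    obtain K k N' q where K: "K \<in> \<T>" "ses A K k N' q N" "has_coresolution A \<C> N' n"
      using Suc.IH[OF T0(3)] by blast
    \<comment> \<open>\<open>P\<close> is the pullback of \<open>T0\<close> and \<open>N'\<close>
      over \<open>N\<close>. As an extension of \<open>T0\<close> by \<open>K\<close> it lies in
      \<open>\<T>\<close>.\<close>
    obtain P a b p r where P: "ses A M a P p N'" "ses A K b P r T0"
      using ses_pullback[OF T0(2) K(2)] .
    have "P \<in> \<T>"
      using coresolvingD(2)[OF T P(2) K(1) T0(1)] .
    then obtain T' X u v where T': "T' \<in> \<T>" "X \<in> \<C>" "ses A T' u X v P"
      using gen by blast
    \<comment> \<open>\<open>M'\<close> is the preimage of \<open>M\<close> in \<open>X\<close>: its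
      quotient in \<open>X\<close> is \<open>N'\<close>, and the kernel of
      \<open>M' \<rightarrow> M\<close> is \<open>T'\<close>.\<close>
    obtain M' m u' w where M': "ses A T' u' M' w M" "ses A M' m X (p \<cdot> v) N'"
      using ses_Comp_epic[OF T'(3) P(1)] .
    have "has_coresolution A \<C> M' (Suc n)"
      using has_coresolution_SucI[OF T'(2) M'(2) K(3)] .
    then show ?case
      using M'(1) T'(1) by blast
  qed
  then show ?thesis
    using that by blast
qed

text \<open>Only the first term changes: \<open>X\<close> becomes \<open>Q = X / K\<close>, which is
  in \<open>\<T>\<close> as a cokernel of a monic, while the cokernel \<open>N\<close> stays the
  same.\<close>

lemma has_coresolution_quotient:
  assumes T: "coresolving A \<T>" and K: "K \<in> \<T>" "ses A K k M' q M"
    and "has_coresolution A \<T> M' n"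
  shows "has_coresolution A \<T> M n"
proof (cases n)
  case 0
  then show ?thesis
    using assms coresolvingD[OF T] has_coresolution_0 by metis
next
  case (Suc m)
  then obtain X f g N where X: "X \<in> \<T>" "ses A M' f X g N" "has_coresolution A \<T> N m"
    using has_coresolution_SucD assms(4) by blast
  obtain Q v a b where "ses A K (f \<cdot> k) X v Q" "ses A M a Q b N"
    using ses_Comp_monic[OF K(2) X(2)] .
  then show ?thesis
    using coresolvingD(3)[OF T] K(1) X has_coresolution_SucI Suc by blast
qed

lemma has_coresolution_summand:
  assumes C: "subcategory A \<C>" and res: "injective_resolution A K I e d"
    and acyclic: "\<And>X. X \<in> \<C> \<Longrightarrow> hom_acyclic A X I d"
    and K: "ses A K k M' q M" and M: "hom_acyclic A M I d" and "has_coresolution A \<C> M' n"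
  shows "has_coresolution A \<C> M n"
proof -
  have summand: "Y \<in> \<C>" if "ses A K j X p Y" "r \<in> Hom A X K" "r \<cdot> j = Ident A K" "X \<in> \<C>" for j X p Y r
    using ses_split[OF that(1-3)] that(4) C unfolding subcategory_def by blast
  have KO: "K \<in> Obj A"
    using Hom_Obj[OF sesD(1)[OF K]] by simp
  \<comment> \<open>Extending the identity of \<open>K\<close> along \<open>k\<close> gives a
    retraction.\<close>
  obtain r where r: "r \<in> Hom A M' K" "r \<cdot> k = Ident A K"
    using hom_acyclic_extend[OF res K M Ident_in_Hom[OF KO]] .
  show ?thesis
  proof (cases n)
    case 0
    then show ?thesis
      using assms(6) has_coresolution_0[OF C] summand[OF K r] by blast
  next
    case (Suc m)
    then obtain X f g N where X: "X \<in> \<C>" "ses A M' f X g N" "has_coresolution A \<C> N m"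
      using has_coresolution_SucD assms(6) by blast
    have N: "hom_acyclic A N I d"
      using has_coresolution_acyclic[OF res C acyclic X(3)] .
    \<comment> \<open>A retraction of \<open>K \<rightarrow> X\<close> is needed; it comes from
      extending \<open>r\<close> along \<open>f\<close>, since Ext from \<open>N\<close> vanishes as
      well.\<close>
    obtain r' where r': "r' \<in> Hom A X K" "r' \<cdot> f = r"
      using hom_acyclic_extend[OF res X(2) N r(1)] .
    obtain Q v a b where Q: "ses A K (f \<cdot> k) X v Q" "ses A M a Q b N"
      using ses_Comp_monic[OF K X(2)] .
    have "r' \<cdot> (f \<cdot> k) = Ident A K"
      using Comp_assoc[OF sesD(1)[OF K] sesD(1)[OF X(2)] r'(1)] r r' by simp
    then have "Q \<in> \<C>"
      using summand[OF Q(1) r'(1)] X(1) by blast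
    then show ?thesis
      using has_coresolution_SucI[OF _ Q(2) X(3)] Suc by blast
  qed
qed

end

section \<open>Relative dimensions and the theorem\<close>

lemma rel_id_le: "has_coresolution A \<X> M n \<Longrightarrow> rel_id A \<X> M \<le> enat n"
  unfolding rel_id_def by (rule Inf_lower) blast

text \<open>A finite infimum comes from a nonempty set, and by well-ordering it is attained.\<close>

lemma rel_id_finite:
  assumes "rel_id A \<X> M < \<infinity>"
  obtains n where "rel_id A \<X> M = enat n" "has_coresolution A \<X> M n"
proof -
  obtain x where "x \<in> {enat n | n. has_coresolution A \<X> M n}"
    using assms unfolding rel_id_def Inf_less_iff by blast
  then have "rel_id A \<X> M \<in> {enat n | n. has_coresolution A \<X> M n}"
    unfolding rel_id_def by (rule wellorder_InfI)
  then obtain n where "rel_id A \<X> M = enat n" "has_coresolution A \<X> M n"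
    by blast
  then show ?thesis
    by (rule that)
qed

lemma rel_id_antimono:
  assumes "\<And>n. has_coresolution A \<X> M n \<Longrightarrow> has_coresolution A \<Y> N n"
  shows "rel_id A \<Y> N \<le> rel_id A \<X> M"
  unfolding rel_id_def by (rule Inf_superset_mono) (use assms in blast)

theorem corollary3p12:
  fixes A :: "('o, 'm) precategory" and \<E> \<T> \<C> :: "'o set"
  assumes "abelian_category A"
    and "enough_injectives A"
    and "subcategory A \<E>"
    and "subcategory A \<C>"
    and "coresolving A \<T>"
    and "proper_generator A \<E> \<C> \<T>"
  shows "FID A \<T> \<le> FID A \<C> \<and>
    (\<T> \<subseteq> right_perp A \<C> \<longrightarrow>
       (\<forall>M\<in>Obj A. rel_id A \<C> M < \<infinity> \<longrightarrow> rel_id A \<T> M = rel_id A \<C> M)) \<and>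
    (\<T> \<subseteq> right_perp A \<C> \<longrightarrow> FID A \<T> = FID A \<C>)"
proof -
  interpret abelian_category A by fact
  note C = assms(4) and T = assms(5)
  have CT: "\<C> \<subseteq> \<T>" and CO: "\<C> \<subseteq> Obj A"
    using assms(6) C by (auto simp: proper_generator_def subcategory_def)
  have gen: "\<exists>T'\<in>\<T>. \<exists>X\<in>\<C>. \<exists>f g. ses A T' f X g T" if "T \<in> \<T>" for T
    using assms(6) that unfolding proper_generator_def short_exact_iff_ses by blast
  have le: "rel_id A \<T> M \<le> rel_id A \<C> M" for M
    by (rule rel_id_antimono) (rule has_coresolution_mono[OF CT])
  have "rel_id A \<T> M \<le> FID A \<C>" if fin: "rel_id A \<T> M < \<infinity>" for M
  proof -
    obtain n where "has_coresolution A \<T> M n"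
      using rel_id_finite[OF fin] .
    then obtain K k M' q where K: "K \<in> \<T>" "ses A K k M' q M" "has_coresolution A \<C> M' n"
      using coresolution_approximation[OF T C gen] by blast
    have "rel_id A \<T> M \<le> rel_id A \<T> M'"
      by (rule rel_id_antimono) (rule has_coresolution_quotient[OF T K(1,2)])
    also have "\<dots> \<le> rel_id A \<C> M'"
      by (rule le)
    also have "\<dots> \<le> FID A \<C>"
    proof -
      have "M' \<in> Obj A"
        using Hom_Obj[OF sesD(1)[OF K(2)]] by simp
      \<comment> \<open>Finiteness lets \<open>M'\<close> contribute to the supremum that defines
        \<open>FID\<close>.\<close>
      moreover have "rel_id A \<C> M' < \<infinity>"
        using rel_id_le[OF K(3)] by (rule le_less_trans) simp
      ultimately show ?thesis
        unfolding FID_def by (intro Sup_upper) blast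
    qed
    finally show ?thesis .
  qed
  then have one: "FID A \<T> \<le> FID A \<C>"
    unfolding FID_def[of A \<T>] by (intro Sup_least) blast
  have two: "rel_id A \<T> M = rel_id A \<C> M"
    if perp: "\<T> \<subseteq> right_perp A \<C>" and fin: "rel_id A \<C> M < \<infinity>" for M
  proof (rule antisym[OF le])
    \<comment> \<open>The length \<open>m\<close> yields the vanishing of Ext from \<open>M\<close>;
      the length carried over from \<open>\<T>\<close> to \<open>\<C>\<close> is
      \<open>n\<close>.\<close>
    obtain m where m: "has_coresolution A \<C> M m"
      using rel_id_finite[OF fin] .
    have "has_coresolution A \<C> M n" if Tn: "has_coresolution A \<T> M n" for n
    proof -
      obtain K k M' q where K: "K \<in> \<T>" "ses A K k M' q M" "has_coresolution A \<C> M' n"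
        using coresolution_approximation[OF T C gen Tn] by blast
      obtain I e d where I: "injective_resolution A K I e d" "\<And>X. X \<in> \<C> \<Longrightarrow> hom_acyclic A X I d"
        using right_perp_acyclic[OF assms(2) _ CO] perp K(1) by blast
      show ?thesis
        using has_coresolution_summand[OF C I K(2) has_coresolution_acyclic[OF I(1) C I(2) m] K(3)] .
    qed
    then show "rel_id A \<C> M \<le> rel_id A \<T> M"
      by (rule rel_id_antimono)
  qed
  have "FID A \<C> \<le> FID A \<T>" if perp: "\<T> \<subseteq> right_perp A \<C>"
    unfolding FID_def[of A \<C>]
  proof (rule Sup_least)
    fix x
    assume "x \<in> {rel_id A \<C> M | M. M \<in> Obj A \<and> rel_id A \<C> M < \<infinity>}"
    then obtain M where "x = rel_id A \<C> M" "M \<in> Obj A" "rel_id A \<C> M < \<infinity>"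
      by blast
    then show "x \<le> FID A \<T>"
      \<comment> \<open>The equality makes \<open>rel_id A \<T> M\<close> finite too, so it is among
        the values of the supremum.\<close>
      using two[OF perp] unfolding FID_def by (intro Sup_upper) force
  qed
  then show ?thesis
    using one two by (auto intro: antisym)
qed

end
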